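(* Let $(X,\alpha,p)$ be a planar $G$-framework with $G=\mathbb Z_m$ or $D_{2m}$, and let $(\mathcal F,\rho)$, $(\overline{k^2},\eta)$, $(\mathcal P,\eta/\rho)$, $\phi$, $\pi$ be as in the context. Let $T\subseteq C_2\overline{k^2}$ be the $G$-submodule of 2-chains assigning one and the same vector of $k^2$ to every face (these are exactly the 2-cycles, i.e. $T=H_2\overline{k^2}$). Then for every irreducible representation $\mu^{(j)}$ of $G$ over $k$ there is a short exact sequence of $kG$-modules $$0\to T^{(j)}\xrightarrow{\pi_*}H_2^{(j)}\mathcal P\xrightarrow{\vartheta^{(j)}}H_1^{(j)}\mathcal F\to0,$$ so that $\vartheta^{(j)}$ induces an isomorphism $H_2^{(j)}\mathcal P/\pi_*(T^{(j)})\cong H_1^{(j)}\mathcal F$: the $\mu^{(j)}$-symmetric self-stresses of the framework correspond bijectively and linearly to the $\mu^{(j)}$-symmetric reciprocal diagrams modulo $\mu^{(j)}$-symmetric global translations.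
   Context: Let $k\in\{\mathbb R,\mathbb C\}$ (when $k=\mathbb C$, points of $\mathbb R^2$ are regarded in $\mathbb C^2$). Let $G$ be $\mathbb Z_m$ or $D_{2m}$ with standard representation $\tau:G\to O(2)$ (rotation generator by $2\pi/m$; reflections in lines through the origin). A planar $G$-framework $(X,\alpha,p)$: $p_v\in\mathbb R^2$ for vertices of a finite graph, $p_u\ne p_v$ for adjacent $u,v$, straight edges meeting only at endpoints; $X$ is the regular cell complex homeomorphic to the 2-sphere with these vertices and edges and with faces the connected components of the complement of the drawing (including the unbounded one). $G$ acts on cells by incidence-preserving permutations $\alpha$ with $p_{gv}=\tau(g)p_v$, $g$ mapping the geometric realization of each cell $c$ onto that of $gc$. Fix a signed incidence relation $[c:d]$ ($[c:d]\ne0$ iff $c\lhd d$ in codimension one; $[u:e][v:e]=-1$ for endpoints of an edge; $\sum_c[b:c][c:d]=0$) with faces oriented consistently. Signs: $[gv,v]=+1$; $[ge,e]=[v:e][gv:ge]$ for an endpoint $v$ of $e$; $[gf,f]=+1$ for rotations, $-1$ for reflections. For a cosheaf $\mathcal K$ (stalks $\mathcal K_c$, functorial extension maps $\mathcal K_{d\rhd c}$ for $c\lhd d$), $C_i\mathcal K=\bigoplus_{\dim c=i}\mathcal K_c$, $(\partial x)_c=\sum_{c\lhd d}[c:d]\mathcal K_{d\rhd c}x_d$, $H_i\mathcal K=\ker\partial_i/\operatorname{im}\partial_{i+1}$. Force cosheaf $\mathcal F$: $\mathcal F_v=k^2$, $\mathcal F_e=k$, $\mathcal F_f=0$, $\mathcal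 F_{e\rhd v}(1)=\mathcal F_{e\rhd u}(1)=[v:e](p_v-p_u)$ for an edge $e$ with endpoints $u,v$; $G$ acts by $\rho_v(g)=\tau(g):\mathcal F_v\to\mathcal F_{gv}$, $\rho_e(g)=1:\mathcal F_e\to\mathcal F_{ge}$. $H_1\mathcal F=\ker\partial_1$ is the space of self-stresses $w$ (scalars $w_e$ with $\sum_{e\ni v}w_e(p_v-p_u)=0$ at each vertex $v$). Constant cosheaf $\overline{k^2}$: stalks $k^2$, identity extension maps, action $\eta_c(g)=[gc,c]\tau(g):k^2\to k^2$ from stalk at $c$ to stalk at $gc$. Cosheaf map $\phi:\mathcal F\to\overline{k^2}$: $\phi_v=\mathrm{id}$, $\phi_e(1)=[v:e](p_v-p_u)$. Position cosheaf $\mathcal P$: stalks $\mathcal P_c=k^2/\phi_c(\mathcal F_c)$ (so $\mathcal P_f=k^2$, $\mathcal P_e=k^2/\operatorname{span}(p_u-p_v)$, $\mathcal P_v=0$), induced extension maps, quotient map $\pi$, action $(\eta/\rho)_c(g)(x+\operatorname{im}\phi_c)=\eta_c(g)x+\operatorname{im}\phi_{gc}$. Elements of $H_2\mathcal P$ are reciprocal diagrams: assignments $\xi_f\in k^2$ to faces such that $\xi_f-\xi_{f'}\in\operatorname{span}(p_u-p_v)$ whenever faces $f,f'$ share the edge with endpoints $u,v$. The connecting homomorphism $\vartheta:H_2\mathcal P\to H_1\mathcal F$ sends the class of a 2-cycle $\xi$ to $\phi^{-1}(\partial\xi)$, where $\xi$ is viewed as a 2-chain of $\overline{k^2}$ and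 $\partial\xi\in\phi(C_1\mathcal F)$. All homology spaces are $kG$-modules via the induced actions. $\mu^{(1)},\dots,\mu^{(m')}$ are the irreducible representations of $G$ over $k$; $V^{(j)}$ denotes the $\mu^{(j)}$-isotypic component (sum of all submodules isomorphic to $\mu^{(j)}$) of a $kG$-module $V$, and $\vartheta^{(j)},\pi_*$ denote restrictions to isotypic components. *)

theory Defs
  imports "HOL-Analysis.Analysis" "HOL-Library.Function_Algebras"
begin

section \<open>Symmetry groups Z_m and D_2m in their standard representation\<close>

definition rot :: "real \<Rightarrow> real^2^2" where
  "rot t = vector [vector [cos t, - sin t], vector [sin t, cos t]]"

definition cyclic_grp :: "nat \<Rightarrow> (real^2^2) set" where
  "cyclic_grp m = {rot (2 * pi * real i / real m) | i. i < m}"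

definition is_reflection :: "real^2^2 \<Rightarrow> bool" where
  "is_reflection s \<longleftrightarrow> orthogonal_matrix s \<and> det s = -1"

definition dihedral_grp :: "nat \<Rightarrow> real^2^2 \<Rightarrow> (real^2^2) set" where
  "dihedral_grp m s = cyclic_grp m \<union> {r ** s | r. r \<in> cyclic_grp m}"

section \<open>Planar frameworks (vertices are identified with their positions p_v)\<close>

definition drawing :: "(real^2) set \<Rightarrow> (real^2) set set \<Rightarrow> (real^2) set" where
  "drawing V E = V \<union> \<Union> ((\<lambda>e. convex hull e) ` E)"

definition faces :: "(real^2) set \<Rightarrow> (real^2) set set \<Rightarrow> (real^2) set set" where
  "faces V E = components (- drawing V E)"

text \<open>Edge e is a codimension-one face of the 2-cell f.\<close>
definition edge_of_face :: "(real^2) set \<Rightarrow> (real^2) set \<Rightarrow> bool" where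
  "edge_of_face e f \<longleftrightarrow> convex hull e \<subseteq> frontier f"

definition planar_framework :: "(real^2) set \<Rightarrow> (real^2) set set \<Rightarrow> bool" where
  "planar_framework V E \<longleftrightarrow>
     finite V \<and> finite E \<and>
     (\<forall>e\<in>E. \<exists>u v. u \<in> V \<and> v \<in> V \<and> u \<noteq> v \<and> e = {u, v}) \<and>
     (\<forall>e\<in>E. \<forall>e'\<in>E. e \<noteq> e' \<longrightarrow> convex hull e \<inter> convex hull e' \<subseteq> e \<inter> e') \<and>
     (\<forall>v\<in>V. \<forall>e\<in>E. v \<in> convex hull e \<longrightarrow> v \<in> e) \<and>
     \<comment> \<open>regularity of the cell complex on the 2-sphere: every closed face is a
         closed disc, i.e. its frontier is a simple closed curve\<close>
     (\<forall>f\<in>faces V E. \<exists>\<gamma>. simple_path \<gamma> \<and> pathfinish \<gamma> = pathstart \<gamma> \<and>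
                         path_image \<gamma> = frontier f)"

text \<open>The group G acts on the framework: \<tau>(g) permutes vertices and edges.\<close>
definition G_framework :: "(real^2^2) set \<Rightarrow> (real^2) set \<Rightarrow> (real^2) set set \<Rightarrow> bool" where
  "G_framework G V E \<longleftrightarrow>
     (\<forall>g\<in>G. (\<lambda>x. g *v x) ` V = V \<and> (\<lambda>e. (\<lambda>x. g *v x) ` e) ` E = E)"

definition gact_set :: "real^2^2 \<Rightarrow> (real^2) set \<Rightarrow> (real^2) set" where
  "gact_set g c = (\<lambda>x. g *v x) ` c"

text \<open>Signed incidence relation, with faces oriented consistently.\<close>
definition signed_incidence ::
  "(real^2) set \<Rightarrow> (real^2) set set \<Rightarrow> (real^2 \<Rightarrow> (real^2) set \<Rightarrow> int)
     \<Rightarrow> ((real^2) set \<Rightarrow> (real^2) set \<Rightarrow> int) \<Rightarrow> bool" where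
  "signed_incidence V E sVE sEF \<longleftrightarrow>
     (\<forall>v\<in>V. \<forall>e\<in>E. sVE v e \<noteq> 0 \<longleftrightarrow> v \<in> e) \<and>
     (\<forall>e\<in>E. \<forall>u v. e = {u, v} \<and> u \<noteq> v \<longrightarrow> sVE u e * sVE v e = -1) \<and>
     (\<forall>e\<in>E. \<forall>f\<in>faces V E. \<bar>sEF e f\<bar> \<le> 1 \<and> (sEF e f \<noteq> 0 \<longleftrightarrow> edge_of_face e f)) \<and>
     (\<forall>v\<in>V. \<forall>f\<in>faces V E. (\<Sum>e\<in>E. sVE v e * sEF e f) = 0) \<and>
     \<comment> \<open>consistent orientation of the faces\<close>
     (\<forall>e\<in>E. (\<Sum>f\<in>faces V E. sEF e f) = 0)"

section \<open>Cosheaf data over k (k = real or complex)\<close>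

definition kvec :: "real^2 \<Rightarrow> 'k::real_field^2" where
  "kvec x = (\<chi> i. of_real (x $ i))"

definition tauk :: "real^2^2 \<Rightarrow> 'k::real_field^2 \<Rightarrow> 'k^2" where
  "tauk g x = (\<chi> i. \<Sum>j\<in>UNIV. of_real (g $ i $ j) * x $ j)"

text \<open>phi_e(1) = F_{e>v}(1) = [v:e](p_v - p_u) (independent of the endpoint v).\<close>
definition edge_vec :: "(real^2 \<Rightarrow> (real^2) set \<Rightarrow> int) \<Rightarrow> (real^2) set \<Rightarrow> 'k::real_field^2" where
  "edge_vec sVE e = (\<Sum>v\<in>e. of_int (sVE v e) *s kvec v)"

text \<open>Boundary of a 2-chain of the constant cosheaf k^2.\<close>
definition bd2 :: "(real^2) set \<Rightarrow> (real^2) set set \<Rightarrow> ((real^2) set \<Rightarrow> (real^2) set \<Rightarrow> int)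
    \<Rightarrow> ((real^2) set \<Rightarrow> 'k::real_field^2) \<Rightarrow> (real^2) set \<Rightarrow> 'k^2" where
  "bd2 V E sEF \<xi> e = (\<Sum>f\<in>faces V E. of_int (sEF e f) *s \<xi> f)"

text \<open>H_1 F = ker \<partial>_1 (self-stresses).\<close>
definition H1F :: "(real^2) set \<Rightarrow> (real^2) set set \<Rightarrow> (real^2 \<Rightarrow> (real^2) set \<Rightarrow> int)
    \<Rightarrow> ((real^2) set \<Rightarrow> 'k::real_field) set" where
  "H1F V E sVE = {w. (\<forall>e. e \<notin> E \<longrightarrow> w e = 0) \<and>
      (\<forall>v\<in>V. (\<Sum>e\<in>E. (of_int (sVE v e) * w e) *s edge_vec sVE e) = 0)}"

text \<open>H_2 P = ker \<partial>_2 (reciprocal diagrams); P_f = k^2 / 0 is identified with k^2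
  and P_e = k^2 / span(phi_e(1)).\<close>
definition H2P :: "(real^2) set \<Rightarrow> (real^2) set set \<Rightarrow> (real^2 \<Rightarrow> (real^2) set \<Rightarrow> int)
    \<Rightarrow> ((real^2) set \<Rightarrow> (real^2) set \<Rightarrow> int) \<Rightarrow> ((real^2) set \<Rightarrow> 'k::real_field^2) set" where
  "H2P V E sVE sEF = {\<xi>. (\<forall>f. f \<notin> faces V E \<longrightarrow> \<xi> f = 0) \<and>
      (\<forall>e\<in>E. \<exists>c. bd2 V E sEF \<xi> e = c *s edge_vec sVE e)}"

text \<open>T: 2-chains of k^2 that are constant on the faces.\<close>
definition Tconst :: "(real^2) set \<Rightarrow> (real^2) set set \<Rightarrow> ((real^2) set \<Rightarrow> 'k::real_field^2) set" where
  "Tconst V E = {\<xi>. \<exists>c. \<forall>f. \<xi> f = (if f \<in> faces V E then c else 0)}"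

text \<open>Connecting homomorphism: \<xi> \<mapsto> phi^{-1}(\<partial>\<xi>).\<close>
definition theta :: "(real^2) set \<Rightarrow> (real^2) set set \<Rightarrow> (real^2 \<Rightarrow> (real^2) set \<Rightarrow> int)
    \<Rightarrow> ((real^2) set \<Rightarrow> (real^2) set \<Rightarrow> int) \<Rightarrow> ((real^2) set \<Rightarrow> 'k::real_field^2)
    \<Rightarrow> (real^2) set \<Rightarrow> 'k" where
  "theta V E sVE sEF \<xi> e =
     (if e \<in> E then (THE c. bd2 V E sEF \<xi> e = c *s edge_vec sVE e) else 0)"

text \<open>G-actions: rho on F (rho_e = 1), and eta/rho on the face stalks of P
  (eta_f(g) = [gf,f] tau(g) with [gf,f] = det g).\<close>
definition actF :: "real^2^2 \<Rightarrow> ((real^2) set \<Rightarrow> 'k::real_field) \<Rightarrow> (real^2) set \<Rightarrow> 'k" where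
  "actF g w = (\<lambda>e. w (gact_set (matrix_inv g) e))"

definition actP :: "real^2^2 \<Rightarrow> ((real^2) set \<Rightarrow> 'k::real_field^2) \<Rightarrow> (real^2) set \<Rightarrow> 'k^2" where
  "actP g \<xi> = (\<lambda>f. of_real (det g) *s tauk g (\<xi> (gact_set (matrix_inv g) f)))"

section \<open>Representations and isotypic components\<close>

definition irrep :: "(real^2^2) set \<Rightarrow> (real^2^2 \<Rightarrow> 'k::field^'n^'n) \<Rightarrow> bool" where
  "irrep G \<mu> \<longleftrightarrow>
     \<mu> (mat 1) = mat 1 \<and> (\<forall>g\<in>G. \<forall>h\<in>G. \<mu> (g ** h) = \<mu> g ** \<mu> h) \<and>
     (\<forall>U. module.subspace (*s) U \<and> (\<forall>g\<in>G. \<forall>x\<in>U. \<mu> g *v x \<in> U)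
          \<longrightarrow> U = {0} \<or> U = UNIV)"

text \<open>The mu-isotypic component of the kG-module S (with scalar multiplication sc and
  G-action act): the span of all submodules isomorphic to mu.\<close>
definition isotypic :: "('k::field \<Rightarrow> 'a::ab_group_add \<Rightarrow> 'a) \<Rightarrow> (real^2^2) set
    \<Rightarrow> (real^2^2 \<Rightarrow> 'a \<Rightarrow> 'a) \<Rightarrow> 'a set \<Rightarrow> (real^2^2 \<Rightarrow> 'k^'n^'n) \<Rightarrow> 'a set" where
  "isotypic sc G act S \<mu> = module.span sc (\<Union> {W. W \<subseteq> S \<and> module.subspace sc W \<and>
       (\<forall>g\<in>G. act g ` W \<subseteq> W) \<and>
       (\<exists>L. (\<forall>x y. L (x + y) = L x + L y) \<and> (\<forall>c x. L (c *s x) = sc c (L x)) \<and>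
            bij_betw L UNIV W \<and> (\<forall>g\<in>G. \<forall>x. L (\<mu> g *v x) = act g (L x)))})"

definition scF :: "'k::field \<Rightarrow> ((real^2) set \<Rightarrow> 'k) \<Rightarrow> (real^2) set \<Rightarrow> 'k" where
  "scF c w = (\<lambda>e. c * w e)"

definition scP :: "'k::field \<Rightarrow> ((real^2) set \<Rightarrow> 'k^2) \<Rightarrow> (real^2) set \<Rightarrow> 'k^2" where
  "scP c \<xi> = (\<lambda>f. c *s \<xi> f)"

section \<open>The claimed short exact sequence for one irreducible representation\<close>

definition ses_claim :: "(real^2^2) set \<Rightarrow> (real^2) set \<Rightarrow> (real^2) set set
    \<Rightarrow> (real^2 \<Rightarrow> (real^2) set \<Rightarrow> int) \<Rightarrow> ((real^2) set \<Rightarrow> (real^2) set \<Rightarrow> int)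
    \<Rightarrow> (real^2^2 \<Rightarrow> 'k::real_field^'n^'n) \<Rightarrow> bool" where
  "ses_claim G V E sVE sEF \<mu> \<longleftrightarrow>
    (let Tj = isotypic scP G actP (Tconst V E) \<mu>;
         Pj = isotypic scP G actP (H2P V E sVE sEF) \<mu>;
         Fj = isotypic scF G actF (H1F V E sVE) \<mu>;
         th = theta V E sVE sEF
     in \<comment> \<open>theta is a kG-module map on H_2 P (pi_* is the identity map)\<close>
        (\<forall>\<xi>\<in>H2P V E sVE sEF. \<forall>\<zeta>\<in>H2P V E sVE sEF. \<forall>a b.
            th (\<lambda>f. a *s \<xi> f + b *s \<zeta> f) = (\<lambda>e. a * th \<xi> e + b * th \<zeta> e)) \<and>
        (\<forall>g\<in>G. \<forall>\<xi>\<in>H2P V E sVE sEF. th (actP g \<xi>) = actF g (th \<xi>)) \<and>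
        \<comment> \<open>exactness of 0 -> T^(j) -> H_2^(j) P -> H_1^(j) F -> 0\<close>
        Tj \<subseteq> Pj \<and>
        th ` Pj = Fj \<and>
        {\<xi> \<in> Pj. th \<xi> = (\<lambda>e. 0)} = Tj)"

end

theory Submission
  imports Defs
begin

text \<open>
  The analytic core is the angle under which an oriented edge is seen from a point z, the imaginary
  part of a logarithm. For a 1-cycle C with coefficients in a normed space the sum of these angles
  weighted by C is locally constant off the support of C (its derivative telescopes at the
  vertices) and jumps by 2 pi C(e) across an edge e.

  Applied to the boundary of a single face f, whose complement has exactly two components by the
  Jordan curve theorem, this shows that the incidence number [e:f] is \<sigma>(f) times the difference
  of the indicators of f being left and right of e; the consistent orientation and the
  connectedness of the plane minus V force \<sigma> to be one global sign. Hence the kernel of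
  \<theta> is T, and since an orthogonal g exchanges left and right according to det g, \<theta> is
  equivariant. Applied to the cycle with coefficients w(e)(p(v) - p(u)) of a self-stress w, the
  weighted sum is itself a reciprocal diagram that \<theta> maps to w.

  The mean over all faces is an equivariant projection of the reciprocal diagrams onto T, so the
  exact sequence splits equivariantly, and Schur's lemma restricts it to isotypic components.
\<close>

section \<open>The angle subtended by a segment\<close>

definition cpx :: "real^2 \<Rightarrow> complex" where
  "cpx x = Complex (x $ 1) (x $ 2)"

text \<open>The counterclockwise quarter turn, which under \<open>cpx\<close> is multiplication by
  i. So \<open>perp d\<close> points to the left of \<open>d\<close>.\<close>

definition perp :: "real^2 \<Rightarrow> real^2" where
  "perp d = vector [- (d $ 2), d $ 1]"

lemma bounded_linear_cpx: "bounded_linear cpx"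
  unfolding cpx_def
  by (intro bounded_linearI'[where 'a="real^2"]) (auto simp: complex_eq_iff)

lemma linear_cpx: "linear cpx"
  using bounded_linear_cpx by (rule bounded_linear.linear)

lemma inj_cpx: "inj cpx"
  by (auto simp: inj_def cpx_def vec_eq_iff forall_2)

lemmas cpx_simps = linear_add[OF linear_cpx] linear_diff[OF linear_cpx] linear_scale[OF linear_cpx]

lemma continuous_cpx [continuous_intros]:
  "continuous_on S f \<Longrightarrow> continuous_on S (\<lambda>x. cpx (f x))"
  by (rule bounded_linear.continuous_on[OF bounded_linear_cpx])

lemma cpx_perp: "cpx (perp d) = \<i> * cpx d"
  by (simp add: cpx_def perp_def complex_eq_iff)

lemma cpx_eq_iff [simp]: "cpx x = cpx y \<longleftrightarrow> x = y"
  using inj_cpx by (auto dest: injD)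

lemma cpx_in_segment: "cpx z \<in> closed_segment (cpx a) (cpx b) \<longleftrightarrow> z \<in> closed_segment a b"
  unfolding closed_segment_linear_image[OF linear_cpx] using inj_cpx by (auto dest: injD)

text \<open>With the principal branch of \<open>Ln\<close> this is the signed angle from
  \<open>a\<close> to \<open>b\<close> seen from \<open>z\<close>, and the branch cut of the
  quotient lies on the segment itself.\<close>

definition view_angle :: "real^2 \<Rightarrow> real^2 \<Rightarrow> real^2 \<Rightarrow> real" where
  "view_angle a b z = Im (Ln ((cpx b - cpx z) / (cpx a - cpx z)))"

text \<open>Solving quotient = \<open>r\<close> \<le> 0 for \<open>z\<close> gives a convex
  combination of \<open>a\<close> and \<open>b\<close>, with weights \<open>- r / (1 - r)\<close>
  and \<open>1 / (1 - r)\<close>. Hence the angle can be discontinuous only on the segment.\<close>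

lemma quotient_not_nonpos:
  fixes a b z :: complex
  assumes "z \<notin> closed_segment a b"
  shows "(b - z) / (a - z) \<notin> \<real>\<^sub>\<le>\<^sub>0"
proof
  assume "(b - z) / (a - z) \<in> \<real>\<^sub>\<le>\<^sub>0"
  then obtain r where r: "(b - z) / (a - z) = of_real r" "r \<le> 0"
    by (auto elim: nonpos_Reals_cases)
  have "a \<noteq> z" using assms by auto
  then have *: "b - z = of_real r * (a - z)"
    using r(1) by (simp add: field_simps)
  have k: "complex_of_real (1 - r) \<noteq> 0"
    using r(2) by simp
  have "of_real (1 - r) * z = b - of_real r * a"
    using * by (simp add: algebra_simps)
  then have "z = (b - of_real r * a) / of_real (1 - r)"
    using k by (metis nonzero_mult_div_cancel_left)
  also have "\<dots> = of_real (- r / (1 - r)) * a + of_real (1 / (1 - r)) * b"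
    by (simp add: diff_divide_distrib)
  also have "- r / (1 - r) = 1 - 1 / (1 - r)" using r(2) by (simp add: field_simps)
  finally have "z = (1 - 1 / (1 - r)) *\<^sub>R a + (1 / (1 - r)) *\<^sub>R b"
    by (simp only: scaleR_conv_of_real)
  moreover have "0 \<le> 1 / (1 - r)" "1 / (1 - r) \<le> 1"
    using r(2) by auto
  ultimately have "z \<in> closed_segment a b"
    unfolding in_segment by blast
  with assms show False ..
qed

lemma view_angle_has_derivative:
  assumes "z \<notin> closed_segment a b"
  shows "(view_angle a b has_derivative
      (\<lambda>h. Im (cpx h / (cpx a - cpx z)) - Im (cpx h / (cpx b - cpx z)))) (at z)"
proof -
  let ?q = "\<lambda>w. (cpx b - w) / (cpx a - w)"
  have z: "cpx z \<notin> closed_segment (cpx a) (cpx b)"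
    using assms by (simp add: cpx_in_segment)
  then have ne: "cpx a - cpx z \<noteq> 0" "cpx b - cpx z \<noteq> 0"
    by auto
  \<comment> \<open>The left side is what the differentiation rules produce, with \<open>A\<close>
    for a - z and \<open>B\<close> for b - z. The right side has one term per end point, which is
    what lets the derivatives telescope along a cycle.\<close>
  have alg: "inverse (B / A) * (((0 - 1) * A - B * (0 - 1)) / (A * A)) = inverse A - inverse B"
    if "A \<noteq> 0" "B \<noteq> 0" for A B :: complex
    using that by (simp add: field_simps)
  have "((\<lambda>w. Ln (?q w)) has_field_derivative
      inverse (cpx a - cpx z) - inverse (cpx b - cpx z)) (at (cpx z))"
    by (rule derivative_eq_intros refl quotient_not_nonpos[OF z] ne alg)+
  then have "((\<lambda>w. Ln (?q w)) has_derivative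
      (\<lambda>h. (inverse (cpx a - cpx z) - inverse (cpx b - cpx z)) * h)) (at (cpx z))"
    by (simp add: has_field_derivative_def)
  from has_derivative_compose[OF bounded_linear_imp_has_derivative[OF bounded_linear_cpx] this]
  have "((\<lambda>x. Im (Ln (?q (cpx x)))) has_derivative
      (\<lambda>h. Im ((inverse (cpx a - cpx z) - inverse (cpx b - cpx z)) * cpx h))) (at z)"
    by (rule bounded_linear.has_derivative[OF bounded_linear_Im])
  moreover have "Im ((inverse A - inverse B) * c) = Im (c / A) - Im (c / B)" for A B c
    by (simp only: divide_inverse left_diff_distrib minus_complex.sel mult.commute[of c])
  ultimately show ?thesis
    unfolding view_angle_def[abs_def] by (simp only:)
qed

text \<open>Near the open segment the quotient approaches the negative real axis, from above on the
  left side and from below on the right, so the two angles tend to pi and -pi.\<close>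

lemma view_angle_jump:
  assumes "a \<noteq> b" "x \<in> open_segment a b"
  shows "((\<lambda>t. view_angle a b (x + t *\<^sub>R perp (b - a)) - view_angle a b (x - t *\<^sub>R perp (b - a)))
     \<longlongrightarrow> 2 * pi) (at_right 0)"
proof -
  obtain s where s: "0 < s" "s < 1" and x: "x = (1 - s) *\<^sub>R a + s *\<^sub>R b"
    using assms(2) unfolding in_segment by auto
  define d where "d = cpx b - cpx a"
  have d: "d \<noteq> 0" using assms(1) by (simp add: d_def)
  \<comment> \<open>The common factor \<open>d\<close> cancels and the minus sign is split off, so
    that \<open>w\<close> tends to the positive real \<open>(1 - s) / s\<close>, where
    \<open>Ln\<close> is continuous and real.\<close>
  define w where "w t = (Complex (1 - s) (- t)) / (Complex s t)" for t
  have eq: "view_angle a b (x + t *\<^sub>R perp (b - a)) = Im (Ln (- w t))" for t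
  proof -
    have cx: "cpx x = cpx a + of_real s * d"
      unfolding x cpx_simps d_def by (simp add: scaleR_conv_of_real algebra_simps)
    have 1: "cpx b - cpx (x + t *\<^sub>R perp (b - a)) = Complex (1 - s) (- t) * d"
      unfolding cpx_simps cpx_perp cx Complex_eq d_def
      by (simp add: scaleR_conv_of_real algebra_simps)
    have 2: "cpx a - cpx (x + t *\<^sub>R perp (b - a)) = - (Complex s t * d)"
      unfolding cpx_simps cpx_perp cx Complex_eq d_def
      by (simp add: scaleR_conv_of_real algebra_simps)
    show ?thesis
      unfolding view_angle_def 1 2 w_def using d by simp
  qed
  \<comment> \<open>Crossing to the other side of the segment conjugates the quotient, which negates
    the angle. The difference is therefore twice the angle on the left.\<close>
  have cnj: "- w (- t) = cnj (- w t)" for t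
    by (simp add: w_def complex_eq_iff Re_divide Im_divide)
  have im: "Im (w t) = - t / (s\<^sup>2 + t\<^sup>2)" for t
    by (simp add: w_def Im_divide algebra_simps)
  have ev: "eventually (\<lambda>t. 2 * Im (Ln (w t)) + 2 * pi =
      view_angle a b (x + t *\<^sub>R perp (b - a)) - view_angle a b (x - t *\<^sub>R perp (b - a))) (at_right 0)"
    using eventually_at_right_less[of 0]
  proof eventually_elim
    case (elim t)
    have "s\<^sup>2 + t\<^sup>2 > 0" using s by (simp add: add_pos_nonneg)
    then have neg: "Im (w t) < 0" unfolding im using elim by (simp add: divide_neg_pos)
    then have "w t \<noteq> 0" by auto
    then have l: "Ln (- w t) = Ln (w t) + \<i> * pi"
      using neg by (simp add: Ln_minus)
    have "- w t \<notin> \<real>\<^sub>\<le>\<^sub>0" using neg by (auto simp: complex_nonpos_Reals_iff)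
    then have "Im (Ln (cnj (- w t))) = - Im (Ln (- w t))"
      by (metis cnj_Ln cnj.sel(2))
    then show ?case
      using eq[of t] eq[of "- t"] l cnj[of t] by simp
  qed
  have "((\<lambda>t. w t) \<longlongrightarrow> (Complex (1 - s) (- 0)) / (Complex s 0)) (at_right 0)"
    unfolding w_def by (intro tendsto_intros) (use s in \<open>auto simp: complex_eq_iff\<close>)
  moreover have "(Complex (1 - s) (- 0)) / (Complex s 0) = of_real ((1 - s) / s)"
    by (simp add: complex_eq_iff Re_divide Im_divide power2_eq_square)
  ultimately have wl: "(w \<longlongrightarrow> of_real ((1 - s) / s)) (at_right 0)" by simp
  have "((\<lambda>t. Ln (w t)) \<longlongrightarrow> Ln (of_real ((1 - s) / s))) (at_right 0)"
    by (rule tendsto_Ln[OF wl]) (use s in \<open>simp add: complex_nonpos_Reals_iff divide_le_0_iff\<close>)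
  then have "((\<lambda>t. 2 * Im (Ln (w t)) + 2 * pi) \<longlongrightarrow> 2 * Im (Ln (of_real ((1 - s) / s))) + 2 * pi) (at_right 0)"
    by (intro tendsto_add tendsto_mult tendsto_const tendsto_Im)
  moreover have "Im (Ln (of_real ((1 - s) / s))) = 0"
    using s by (subst Ln_of_real) auto
  ultimately show ?thesis
    using filterlim_cong[OF refl refl ev] by simp
qed

text \<open>By the Jordan curve theorem the complement of \<open>frontier f\<close> has exactly two
  components. The connected set \<open>f\<close> lies in one of them and fills it, since that
  component cannot leave \<open>f\<close> without meeting the frontier; the complement of the
  closure is the other one.\<close>

lemma connected_Compl_closure_of_Jordan_frontier:
  fixes f :: "(real^2) set"
  assumes "open f" "connected f" "f \<noteq> {}"
    and "simple_path \<gamma>" "pathfinish \<gamma> = pathstart \<gamma>" "path_image \<gamma> = frontier f"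
  shows "connected (- closure f)"
proof -
  define c where "c = cpx \<circ> \<gamma>"
  have "simple_path c"
    unfolding c_def using assms(4) linear_cpx inj_cpx
    by (simp add: simple_path_linear_image_eq)
  moreover have "pathfinish c = pathstart c"
    using assms(5) by (simp add: c_def pathfinish_compose pathstart_compose)
  moreover have J: "path_image c = cpx ` frontier f"
    by (simp add: c_def path_image_compose assms(6))
  ultimately obtain U W where UW: "open U" "connected U" "open W" "connected W"
      "U \<inter> W = {}" "U \<union> W = - cpx ` frontier f"
    using Jordan_curve[of c] by metis
  have co: "continuous_on UNIV cpx" by (intro continuous_intros)
  define A where "A = cpx -` U"
  define B where "B = cpx -` W"
  have vc: "connected (cpx -` S)" if "connected S" for S
  proof -
    define r :: "complex \<Rightarrow> real^2" where "r z = (\<chi> i. if i = 1 then Re z else Im z)" for z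
    have "continuous_on S r"
      unfolding r_def
    proof (intro continuous_on_vec_lambda)
      show "continuous_on S (\<lambda>x. if i = 1 then Re x else Im x)" for i :: 2
        by (cases "i = 1") (auto intro: continuous_intros)
    qed
    then have "connected (r ` S)" using that by (rule connected_continuous_image)
    moreover have "r (cpx x) = x" "cpx (r z) = z" for x z
      by (auto simp: r_def cpx_def vec_eq_iff forall_2)
    then have "cpx -` S = r ` S" by (auto simp: image_iff) metis+
    ultimately show ?thesis by simp
  qed
  have AB: "open A" "open B" "connected A" "connected B" "A \<inter> B = {}"
    unfolding A_def B_def using UW co by (auto intro: open_vimage vc)
  have un: "A \<union> B = - frontier f"
    unfolding A_def B_def using UW(6) inj_cpx by (auto dest: injD)
  have ff: "f \<inter> frontier f = {}" using assms(1) by (auto simp: frontier_def interior_open)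
  have cl: "closure f = f \<union> frontier f"
    using assms(1) by (metis closure_Un_frontier)
  \<comment> \<open>\<open>f\<close> may be either of the two Jordan domains, so the argument is
    kept symmetric in them.\<close>
  have key: "- closure f = B'" if "A' \<union> B' = - frontier f" "A' \<inter> B' = {}" "open B'" "open A'"
      "connected A'" "f \<inter> A' \<noteq> {}" for A' B'
  proof -
    have "f \<subseteq> A'"
      using connectedD[OF assms(2) that(4,3)] that ff by blast
    moreover have "A' \<inter> frontier f = {}" using that by auto
    with that(5,6) have "A' \<subseteq> f" using connected_Int_frontier[of A' f] by blast
    ultimately show ?thesis using cl that by blast
  qed
  have "f \<inter> A \<noteq> {} \<or> f \<inter> B \<noteq> {}" using un ff assms(3) by blast
  then show ?thesis
    using key[of A B] key[of B A] AB un by (metis Int_commute Un_commute)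
qed

section \<open>Weighted sums of viewing angles\<close>

locale oriented_framework =
  fixes V :: "(real^2) set" and E :: "(real^2) set set"
    and sVE :: "real^2 \<Rightarrow> (real^2) set \<Rightarrow> int"
    and sEF :: "(real^2) set \<Rightarrow> (real^2) set \<Rightarrow> int"
  assumes framework: "planar_framework V E"
    and incidence: "signed_incidence V E sVE sEF"
begin

lemma finite_V: "finite V" and finite_E: "finite E"
  using framework by (auto simp: planar_framework_def)

definition head :: "(real^2) set \<Rightarrow> real^2" where
  "head e = (THE v. v \<in> e \<and> sVE v e = 1)"

definition tail :: "(real^2) set \<Rightarrow> real^2" where
  "tail e = (THE v. v \<in> e \<and> sVE v e = -1)"

lemma ends_product: "e \<in> E \<Longrightarrow> e = {u, v} \<Longrightarrow> u \<noteq> v \<Longrightarrow> sVE u e * sVE v e = -1"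
  using incidence unfolding signed_incidence_def by blast

lemma head_eqI:
  assumes "e \<in> E" "e = {u, v}" "u \<noteq> v" "sVE v e = 1"
  shows "head e = v" "tail e = u" "sVE u e = -1"
proof -
  show u: "sVE u e = -1"
    using ends_product[OF assms(1-3)] assms(4) by simp
  show "head e = v" "tail e = u"
    unfolding head_def tail_def using assms u by (auto intro!: the_equality)
qed

text \<open>Integers with product -1 are units, so one of the two is 1 and the incidence numbers
  orient the edge.\<close>

lemma edge_cases:
  assumes "e \<in> E" "e = {u, v}" "u \<noteq> v"
  shows "sVE v e = 1 \<or> sVE u e = 1"
proof -
  have "sVE v e * (- sVE u e) = 1"
    using ends_product[OF assms] by (simp add: mult.commute)
  then show ?thesis
    unfolding zmult_eq_1_iff by auto
qed

lemma edge_ends: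
  assumes "e \<in> E"
  shows "e = {tail e, head e}" "tail e \<noteq> head e" "tail e \<in> V" "head e \<in> V"
    "sVE (tail e) e = -1" "sVE (head e) e = 1"
proof -
  obtain u v where uv: "u \<in> V" "v \<in> V" "u \<noteq> v" "e = {u, v}"
    using framework assms by (auto simp: planar_framework_def)
  have "e = {tail e, head e} \<and> tail e \<noteq> head e \<and> tail e \<in> V \<and> head e \<in> V \<and>
      sVE (tail e) e = -1 \<and> sVE (head e) e = 1"
    using edge_cases[OF assms uv(4,3)]
  proof
    assume "sVE v e = 1"
    from head_eqI[OF assms uv(4,3) this] this show ?thesis using uv by simp
  next
    assume u: "sVE u e = 1"
    have e: "e = {v, u}" using uv by auto
    from head_eqI[OF assms e uv(3)[symmetric] u] u e show ?thesis using uv(1-3) by simp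
  qed
  then show "e = {tail e, head e}" "tail e \<noteq> head e" "tail e \<in> V" "head e \<in> V"
    "sVE (tail e) e = -1" "sVE (head e) e = 1"
    by - (elim conjE, assumption)+
qed

lemma in_edge_iff: "e \<in> E \<Longrightarrow> x \<in> e \<longleftrightarrow> x = tail e \<or> x = head e"
  using arg_cong[OF edge_ends(1)[of e], of "\<lambda>S. x \<in> S"] by simp

lemma hull_edge: "e \<in> E \<Longrightarrow> convex hull e = closed_segment (tail e) (head e)"
  using arg_cong[OF edge_ends(1)[of e], of "\<lambda>S. convex hull S"] by (simp only: segment_convex_hull)

text \<open>The coboundary of a vertex function: incidence numbers vanish away from the ends of
  \<open>e\<close>. It converts sums over edges into sums over vertices.\<close>

lemma sum_sVE:
  fixes \<omega> :: "real^2 \<Rightarrow> 'a::real_vector"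
  assumes "e \<in> E"
  shows "(\<Sum>v\<in>V. of_int (sVE v e) *\<^sub>R \<omega> v) = \<omega> (head e) - \<omega> (tail e)"
proof -
  note ee = edge_ends[OF assms]
  have "(\<Sum>v\<in>V. of_int (sVE v e) *\<^sub>R \<omega> v) = (\<Sum>v\<in>{tail e, head e}. of_int (sVE v e) *\<^sub>R \<omega> v)"
  proof (rule sum.mono_neutral_right)
    show "\<forall>v\<in>V - {tail e, head e}. of_int (sVE v e) *\<^sub>R \<omega> v = 0"
      using incidence assms in_edge_iff[OF assms] unfolding signed_incidence_def by auto
  qed (use finite_V ee(3,4) in auto)
  also have "\<dots> = \<omega> (head e) - \<omega> (tail e)"
    using ee(2,5,6) by simp
  finally show ?thesis .
qed

text \<open>For a 1-cycle C this is, up to the factor 2 pi, the winding number of C about z,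
  with vector coefficients.\<close>
definition view_sum :: "((real^2) set \<Rightarrow> 'a::real_normed_vector) \<Rightarrow> real^2 \<Rightarrow> 'a" where
  "view_sum C z = (\<Sum>e\<in>E. view_angle (tail e) (head e) z *\<^sub>R C e)"

lemma view_sum_constant:
  fixes C :: "(real^2) set \<Rightarrow> 'a::real_normed_vector"
  assumes cycle: "\<And>v. v \<in> V \<Longrightarrow> (\<Sum>e\<in>E. of_int (sVE v e) *\<^sub>R C e) = 0"
    and S: "open S" "connected S"
    and disj: "\<And>e. e \<in> E \<Longrightarrow> C e \<noteq> 0 \<Longrightarrow> S \<inter> convex hull e = {}"
    and z: "z \<in> S" "z' \<in> S"
  shows "view_sum C z = view_sum C z'"
proof (rule has_derivative_zero_unique_connected[OF S _ z])
  fix x assume x: "x \<in> S"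
  define \<omega> where "\<omega> h v = Im (cpx h / (cpx v - cpx x))" for h v
  have "((\<lambda>z. view_angle (tail e) (head e) z *\<^sub>R C e) has_derivative
      (\<lambda>h. (\<omega> h (tail e) - \<omega> h (head e)) *\<^sub>R C e)) (at x)" if e: "e \<in> E" for e
  proof (cases "C e = 0")
    case False
    then have "x \<notin> closed_segment (tail e) (head e)"
      using disj[OF e] x hull_edge[OF e] by auto
    from view_angle_has_derivative[OF this] show ?thesis
      unfolding \<omega>_def by (rule has_derivative_scaleR_left)
  qed simp
  then have "(view_sum C has_derivative
      (\<lambda>h. \<Sum>e\<in>E. (\<omega> h (tail e) - \<omega> h (head e)) *\<^sub>R C e)) (at x)"
    unfolding view_sum_def[abs_def] by (intro has_derivative_sum) auto
  moreover have "(\<Sum>e\<in>E. (\<omega> h (tail e) - \<omega> h (head e)) *\<^sub>R C e) = 0" for h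
  proof -
    \<comment> \<open>Up to sign the derivative pairs \<open>C\<close> with the coboundary of
      \<open>\<omega> h\<close>; exchanging the sums pairs \<open>\<omega> h v\<close> with the
      cycle condition at \<open>v\<close>.\<close>
    have "(\<Sum>e\<in>E. (\<omega> h (head e) - \<omega> h (tail e)) *\<^sub>R C e)
        = (\<Sum>e\<in>E. (\<Sum>v\<in>V. of_int (sVE v e) *\<^sub>R \<omega> h v) *\<^sub>R C e)"
      by (intro sum.cong refl) (simp only: sum_sVE)
    also have "\<dots> = (\<Sum>e\<in>E. \<Sum>v\<in>V. \<omega> h v *\<^sub>R of_int (sVE v e) *\<^sub>R C e)"
      by (simp add: scaleR_sum_left mult.commute)
    also have "\<dots> = (\<Sum>v\<in>V. \<omega> h v *\<^sub>R (\<Sum>e\<in>E. of_int (sVE v e) *\<^sub>R C e))"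
      by (subst sum.swap) (simp only: scaleR_sum_right)
    also have "\<dots> = 0"
      by (simp add: cycle)
    finally show ?thesis
      by (simp add: scaleR_left_diff_distrib sum_subtractf)
  qed
  ultimately show "(view_sum C has_derivative (\<lambda>h. 0)) (at x)"
    by simp
qed

section \<open>The two sides of an edge\<close>

definition edge_normal :: "(real^2) set \<Rightarrow> real^2" where
  "edge_normal e = perp (head e - tail e)"

definition inner_edge :: "(real^2) set \<Rightarrow> (real^2) set" where
  "inner_edge e = open_segment (tail e) (head e)"

text \<open>L and R are the faces to the left and to the right of the oriented edge e near its
  point x. They may coincide a priori.\<close>
definition sides :: "(real^2) set \<Rightarrow> real^2 \<Rightarrow> real \<Rightarrow> (real^2) set \<Rightarrow> (real^2) set \<Rightarrow> bool" where
  "sides e x \<delta> L R \<longleftrightarrow> 0 < \<delta> \<and> L \<in> faces V E \<and> R \<in> faces V E \<and>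
     (\<forall>y\<in>ball x \<delta>. (0 < edge_normal e \<bullet> (y - x) \<longrightarrow> y \<in> L) \<and>
        (edge_normal e \<bullet> (y - x) < 0 \<longrightarrow> y \<in> R) \<and>
        (edge_normal e \<bullet> (y - x) = 0 \<longrightarrow> y \<in> inner_edge e))"

lemma edge_normal_nonzero: "e \<in> E \<Longrightarrow> edge_normal e \<noteq> 0"
  using edge_ends(2)[of e] by (auto simp: edge_normal_def perp_def vec_eq_iff forall_2)

lemma inner_edge_other:
  assumes "e \<in> E" "x \<in> inner_edge e"
  shows "x \<in> convex hull e" "x \<notin> V" "e' \<in> E \<Longrightarrow> e' \<noteq> e \<Longrightarrow> x \<notin> convex hull e'"
proof -
  show h: "x \<in> convex hull e"
    using assms hull_edge[of e] by (auto simp: inner_edge_def open_segment_def)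
  have "x \<notin> e"
    using assms by (auto simp: in_edge_iff inner_edge_def open_segment_def)
  then show "x \<notin> V" "e' \<in> E \<Longrightarrow> e' \<noteq> e \<Longrightarrow> x \<notin> convex hull e'"
    using framework assms(1) h unfolding planar_framework_def by blast+
qed

lemma edge_normal_inner_zero:
  assumes "e \<in> E" "x \<in> convex hull e" "y \<in> convex hull e"
  shows "edge_normal e \<bullet> (y - x) = 0"
proof -
  obtain s t where x: "x = (1 - s) *\<^sub>R tail e + s *\<^sub>R head e" and y: "y = (1 - t) *\<^sub>R tail e + t *\<^sub>R head e"
    using assms by (simp add: hull_edge in_segment) blast
  show ?thesis
    unfolding x y by (simp add: edge_normal_def perp_def inner_vec_def sum_2 algebra_simps)
qed

lemma closed_drawing: "closed (drawing V E)"
  unfolding drawing_def using finite_V finite_E framework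
  by (intro closed_Un finite_imp_closed closed_Union)
     (auto simp: planar_framework_def intro!: compact_imp_closed compact_convex_hull)

lemma open_faces: "f \<in> faces V E \<Longrightarrow> open f"
  unfolding faces_def by (metis open_components open_Compl closed_drawing)

lemma connected_faces: "f \<in> faces V E \<Longrightarrow> connected f"
  and faces_nonempty: "f \<in> faces V E \<Longrightarrow> f \<noteq> {}"
  and faces_disjoint_drawing: "f \<in> faces V E \<Longrightarrow> f \<inter> drawing V E = {}"
  unfolding faces_def
  by (auto dest: in_components_connected in_components_nonempty in_components_subset)

lemma faces_eq: "f \<in> faces V E \<Longrightarrow> f' \<in> faces V E \<Longrightarrow> z \<in> f \<Longrightarrow> z \<in> f' \<Longrightarrow> f = f'"
  unfolding faces_def by (metis components_eq disjoint_iff)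

lemma connected_subset_face:
  assumes "connected S" "S \<noteq> {}" "S \<inter> drawing V E = {}"
  obtains f where "f \<in> faces V E" "S \<subseteq> f"
  using exists_component_superset[of S "- drawing V E"] assms unfolding faces_def by blast

text \<open>The rest of the drawing is closed and misses \<open>x\<close>, so a small ball meets
  only \<open>e\<close>, which cuts it into two half balls. Each half is convex and avoids the
  drawing, hence lies in a single face.\<close>

lemma sides_exist:
  assumes e: "e \<in> E" and x: "x \<in> inner_edge e"
  obtains \<delta> L R where "sides e x \<delta> L R"
proof -
  define n where "n = edge_normal e"
  define d where "d = head e - tail e"
  have n: "n \<noteq> 0" "d \<noteq> 0" using edge_normal_nonzero[OF e] edge_ends(2)[OF e] by (auto simp: n_def d_def)
  obtain s where s: "0 < s" "s < 1" "x = (1 - s) *\<^sub>R tail e + s *\<^sub>R head e"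
    using x by (auto simp: inner_edge_def in_segment)
  define D where "D = V \<union> \<Union> ((\<lambda>e. convex hull e) ` (E - {e}))"
  have "closed D"
    unfolding D_def using finite_V finite_E framework
    by (intro closed_Un finite_imp_closed closed_Union)
       (auto simp: planar_framework_def intro!: compact_imp_closed compact_convex_hull)
  moreover have "x \<notin> D" using inner_edge_other[OF e x] by (auto simp: D_def)
  ultimately obtain \<delta>1 where \<delta>1: "0 < \<delta>1" "ball x \<delta>1 \<inter> D = {}"
    by (metis open_Compl ComplI openE disjoint_eq_subset_Compl)
  \<comment> \<open>The last two bounds are the distances from \<open>x\<close> to the ends of
    \<open>e\<close>; they keep the part of the edge line inside the ball within the open
    segment.\<close>
  define \<delta> where "\<delta> = min \<delta>1 (min (s * norm d) ((1 - s) * norm d))"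
  have \<delta>: "0 < \<delta>" using \<delta>1 s n by (simp add: \<delta>_def)
  have line: "y \<in> inner_edge e" if y: "y \<in> ball x \<delta>" and 0: "n \<bullet> (y - x) = 0" for y
  proof -
    \<comment> \<open>The coefficient of the projection of \<open>y - x\<close> to \<open>d\<close>.
      In the plane a vector orthogonal to \<open>n\<close> equals that projection.\<close>
    define t where "t = ((y - x) \<bullet> d) / (d \<bullet> d)"
    have dd: "d \<bullet> d \<noteq> 0" using n by simp
    have "(y - x) = t *\<^sub>R d"
    proof -
      have 0: "d $ 1 * (y - x) $ 2 = d $ 2 * (y - x) $ 1"
        using 0 by (simp add: n_def edge_normal_def d_def perp_def inner_vec_def sum_2 algebra_simps)
      have *: "(d \<bullet> d) *\<^sub>R (y - x) = ((y - x) \<bullet> d) *\<^sub>R d"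
        unfolding vec_eq_iff forall_2
        using arg_cong[OF 0, of "\<lambda>c. d $ 1 * c"] arg_cong[OF 0, of "\<lambda>c. d $ 2 * c"]
        by (simp add: inner_vec_def sum_2 algebra_simps)
      have "y - x = (1 / (d \<bullet> d)) *\<^sub>R ((d \<bullet> d) *\<^sub>R (y - x))"
        using dd by simp
      also have "\<dots> = t *\<^sub>R d"
        unfolding * t_def by simp
      finally show ?thesis .
    qed
    then have yx: "y = x + t *\<^sub>R d" by (simp add: algebra_simps)
    have "\<bar>t\<bar> * norm d < min (s * norm d) ((1 - s) * norm d)"
      using y unfolding yx \<delta>_def by (simp add: dist_norm)
    then have "\<bar>t\<bar> < s" "\<bar>t\<bar> < 1 - s"
      using n by auto
    then have "0 < s + t" "s + t < 1" by auto
    moreover have "y = (1 - (s + t)) *\<^sub>R tail e + (s + t) *\<^sub>R head e"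
      unfolding yx s(3) d_def by (simp add: algebra_simps)
    ultimately show ?thesis
      using edge_ends(2)[OF e] unfolding inner_edge_def in_segment by blast
  qed
  have half: "\<exists>f\<in>faces V E. ball x \<delta> \<inter> {y. 0 < k \<bullet> (y - x)} \<subseteq> f" if k: "k = n \<or> k = - n" for k
  proof -
    let ?H = "ball x \<delta> \<inter> {y. 0 < k \<bullet> (y - x)}"
    have "?H = ball x \<delta> \<inter> {y. k \<bullet> x < k \<bullet> y}"
      by (auto simp: inner_diff_right)
    then have "connected ?H"
      by (simp add: convex_Int convex_connected convex_halfspace_gt)
    moreover have "x + (\<delta> / (2 * norm k)) *\<^sub>R k \<in> ?H"
      using k n \<delta> by (auto simp: dist_norm)
    then have "?H \<noteq> {}" by blast
    ultimately have "connected ?H" "?H \<noteq> {}" by blast+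
    moreover have "?H \<inter> drawing V E = {}"
    proof -
      have "drawing V E = D \<union> convex hull e"
        using e by (auto simp: drawing_def D_def)
      moreover have "?H \<inter> D = {}" using \<delta>1 by (auto simp: \<delta>_def)
      moreover have "?H \<inter> convex hull e = {}"
        using edge_normal_inner_zero[OF e inner_edge_other(1)[OF e x]] k by (auto simp: n_def)
      ultimately show ?thesis by blast
    qed
    ultimately obtain f where "f \<in> faces V E" "?H \<subseteq> f"
      by (rule connected_subset_face)
    then show ?thesis by blast
  qed
  obtain L R where "L \<in> faces V E" "ball x \<delta> \<inter> {y. 0 < n \<bullet> (y - x)} \<subseteq> L"
     "R \<in> faces V E" "ball x \<delta> \<inter> {y. 0 < (- n) \<bullet> (y - x)} \<subseteq> R"
    using half[of n] half[of "- n"] by auto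
  then have "sides e x \<delta> L R"
    unfolding sides_def n_def[symmetric] using \<delta> line by auto
  then show ?thesis by (rule that)
qed

lemma sides_approach:
  assumes "e \<in> E" "sides e x \<delta> L R"
  shows "\<forall>\<^sub>F t in at_right 0. x + t *\<^sub>R edge_normal e \<in> L \<and> x - t *\<^sub>R edge_normal e \<in> R"
proof -
  let ?n = "edge_normal e"
  have n: "?n \<noteq> 0" using edge_normal_nonzero[OF assms(1)] .
  have "0 < \<delta> / norm ?n" using assms n by (simp add: sides_def)
  then have "\<forall>\<^sub>F t in at_right 0. t \<in> {0<..<\<delta> / norm ?n}"
    by (rule eventually_at_right_real)
  then show ?thesis
  proof eventually_elim
    case (elim t)
    then have "x + t *\<^sub>R ?n \<in> ball x \<delta>" "x - t *\<^sub>R ?n \<in> ball x \<delta>"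
      using n by (auto simp: dist_norm field_simps)
    moreover have "0 < ?n \<bullet> (x + t *\<^sub>R ?n - x)" "?n \<bullet> (x - t *\<^sub>R ?n - x) < 0"
      using elim n by auto
    ultimately show ?case using assms(2) unfolding sides_def by blast
  qed
qed

text \<open>Only the term of \<open>e\<close> is discontinuous at \<open>x\<close>, so approaching
  \<open>x\<close> along the normal from both sides isolates its jump. The difference of the sums is
  already constant for small parameters.\<close>

lemma view_sum_jump:
  fixes C :: "(real^2) set \<Rightarrow> 'a::real_normed_vector"
  assumes e: "e \<in> E" and x: "x \<in> inner_edge e" and sides: "sides e x \<delta> L R"
    and l: "\<And>z. z \<in> L \<Longrightarrow> view_sum C z = l" and r: "\<And>z. z \<in> R \<Longrightarrow> view_sum C z = r"
  shows "l - r = (2 * pi) *\<^sub>R C e"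
proof -
  let ?n = "edge_normal e"
  let ?a = "\<lambda>e' z. view_angle (tail e') (head e') z"
  have "((\<lambda>t. ?a e' (x + t *\<^sub>R ?n) - ?a e' (x - t *\<^sub>R ?n)) \<longlongrightarrow> (if e' = e then 2 * pi else 0)) (at_right 0)"
    if e': "e' \<in> E" for e'
  proof (cases "e' = e")
    case True
    then show ?thesis
      using view_angle_jump[OF edge_ends(2)[OF e]] x by (simp add: edge_normal_def inner_edge_def)
  next
    case False
    then have "x \<notin> closed_segment (tail e') (head e')"
      using inner_edge_other(3)[OF e x e'] hull_edge[OF e'] by simp
    then have c: "isCont (?a e') x"
      by (rule has_derivative_continuous[OF view_angle_has_derivative])
    have "((\<lambda>t. x + t *\<^sub>R ?n) \<longlongrightarrow> x + 0 *\<^sub>R ?n) (at_right 0)"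
      "((\<lambda>t. x - t *\<^sub>R ?n) \<longlongrightarrow> x - 0 *\<^sub>R ?n) (at_right 0)"
      by (intro tendsto_intros)+
    then have "((\<lambda>t. ?a e' (x + t *\<^sub>R ?n)) \<longlongrightarrow> ?a e' x) (at_right 0)"
      "((\<lambda>t. ?a e' (x - t *\<^sub>R ?n)) \<longlongrightarrow> ?a e' x) (at_right 0)"
      by (auto intro: isCont_tendsto_compose[OF c])
    from tendsto_diff[OF this] show ?thesis using False by simp
  qed
  then have "((\<lambda>t. \<Sum>e'\<in>E. (?a e' (x + t *\<^sub>R ?n) - ?a e' (x - t *\<^sub>R ?n)) *\<^sub>R C e')
      \<longlongrightarrow> (\<Sum>e'\<in>E. (if e' = e then 2 * pi else 0) *\<^sub>R C e')) (at_right 0)"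
    by (intro tendsto_intros)
  also have "(\<Sum>e'\<in>E. (if e' = e then 2 * pi else 0) *\<^sub>R C e') = (2 * pi) *\<^sub>R C e"
    using e finite_E by (simp add: if_distrib[where f="\<lambda>c. c *\<^sub>R _"] cong: if_cong)
  finally have lim: "((\<lambda>t. \<Sum>e'\<in>E. (?a e' (x + t *\<^sub>R ?n) - ?a e' (x - t *\<^sub>R ?n)) *\<^sub>R C e')
      \<longlongrightarrow> (2 * pi) *\<^sub>R C e) (at_right 0)" .
  have "\<forall>\<^sub>F t in at_right 0.
     (\<Sum>e'\<in>E. (?a e' (x + t *\<^sub>R ?n) - ?a e' (x - t *\<^sub>R ?n)) *\<^sub>R C e') = l - r"
    using sides_approach[OF e sides]
  proof eventually_elim
    case (elim t)
    then have "view_sum C (x + t *\<^sub>R ?n) - view_sum C (x - t *\<^sub>R ?n) = l - r"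
      using l r by simp
    then show ?case
      by (simp add: view_sum_def scaleR_left_diff_distrib sum_subtractf)
  qed
  then have "((\<lambda>t. \<Sum>e'\<in>E. (?a e' (x + t *\<^sub>R ?n) - ?a e' (x - t *\<^sub>R ?n)) *\<^sub>R C e')
      \<longlongrightarrow> l - r) (at_right 0)"
    by (rule tendsto_eventually)
  from tendsto_unique[OF trivial_limit_at_right_real this lim] show ?thesis .
qed

end

section \<open>Incidence numbers and orientation\<close>

context oriented_framework
begin

section \<open>Edges on the frontier of a face\<close>

lemma inner_edge_subset: "e \<in> E \<Longrightarrow> inner_edge e \<subseteq> convex hull e"
  by (auto simp: inner_edge_other(1))

lemma convex_hull_subset_drawing: "e \<in> E \<Longrightarrow> convex hull e \<subseteq> drawing V E"
  by (auto simp: drawing_def)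

lemma sides_inner_edge: "sides e x \<delta> L R \<Longrightarrow> x \<in> inner_edge e"
  by (auto simp: sides_def)

text \<open>Points of \<open>f\<close> close to \<open>x\<close> avoid the drawing, so they lie in
  one of the two half balls, and faces that meet coincide.\<close>

lemma frontier_side:
  assumes "e \<in> E" "sides e x \<delta> L R" "f \<in> faces V E" "x \<in> closure f"
  shows "f = L \<or> f = R"
proof -
  have "0 < \<delta>" using assms(2) by (simp add: sides_def)
  then obtain y where y: "y \<in> f" "y \<in> ball x \<delta>"
    using assms(4) unfolding closure_approachable by (auto simp: dist_commute)
  have "y \<notin> inner_edge e"
    using y assms(1,3) faces_disjoint_drawing convex_hull_subset_drawing inner_edge_subset by blast
  then have "y \<in> L \<or> y \<in> R" "L \<in> faces V E" "R \<in> faces V E"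
    using assms(2) y(2) unfolding sides_def by (meson linorder_less_linear)+
  then show ?thesis
    using faces_eq[OF assms(3) _ y(1)] by blast
qed

lemma sides_frontier:
  assumes e: "e \<in> E" and s: "sides e x \<delta> L R" and x': "x' \<in> inner_edge e" "x' \<in> ball x \<delta>"
    and f: "f = L \<or> f = R"
  shows "x' \<in> frontier f"
proof -
  let ?n = "edge_normal e"
  have ff: "f \<in> faces V E" using s f by (auto simp: sides_def)
  have "x' \<notin> f"
    using x'(1) e ff faces_disjoint_drawing convex_hull_subset_drawing inner_edge_subset by blast
  moreover have "x' \<in> closure f"
  proof -
    \<comment> \<open>The sign \<epsilon> treats both sides at once: moving from \<open>x'\<close> a
      little along \<epsilon> times the normal leads into \<open>f\<close>.\<close>
    obtain \<epsilon> where \<epsilon>: "\<epsilon> = 1 \<or> \<epsilon> = (-1::real)" "\<And>y. y \<in> ball x \<delta> \<Longrightarrow> 0 < \<epsilon> * (?n \<bullet> (y - x)) \<Longrightarrow> y \<in> f"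
      using f
    proof
      assume "f = L"
      then show ?thesis using that[of 1] s by (auto simp: sides_def)
    next
      assume "f = R"
      then show ?thesis using that[of "-1"] s by (auto simp: sides_def)
    qed
    have n: "?n \<noteq> 0" using edge_normal_nonzero[OF e] .
    have 0: "?n \<bullet> (x' - x) = 0"
      using edge_normal_inner_zero[OF e] inner_edge_subset[OF e] sides_inner_edge[OF s] x'(1) by blast
    have lim: "((\<lambda>t. x' + (\<epsilon> * t) *\<^sub>R ?n) \<longlongrightarrow> x' + (\<epsilon> * 0) *\<^sub>R ?n) (at_right 0)"
      by (intro tendsto_intros)
    then have "\<forall>\<^sub>F t in at_right 0. x' + (\<epsilon> * t) *\<^sub>R ?n \<in> ball x \<delta>"
      using x'(2) by (intro topological_tendstoD[OF lim]) auto
    then have "\<forall>\<^sub>F t in at_right 0. x' + (\<epsilon> * t) *\<^sub>R ?n \<in> f"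
      using eventually_at_right_less[of 0]
    proof eventually_elim
      case (elim t)
      have "?n \<bullet> (x' + (\<epsilon> * t) *\<^sub>R ?n - x) = \<epsilon> * t * (?n \<bullet> ?n)"
        using 0 by (simp add: inner_diff_right inner_add_right)
      then have "\<epsilon> * (?n \<bullet> (x' + (\<epsilon> * t) *\<^sub>R ?n - x)) = t * (?n \<bullet> ?n)"
        using \<epsilon>(1) by auto
      then show ?case using elim n by (intro \<epsilon>(2)) auto
    qed
    then have "\<forall>\<^sub>F t in at_right 0. x' + (\<epsilon> * t) *\<^sub>R ?n \<in> closure f"
      by eventually_elim (use closure_subset in blast)
    from Lim_in_closed_set[OF closed_closure this trivial_limit_at_right_real lim]
    show ?thesis by simp
  qed
  ultimately show ?thesis
    using open_faces[OF ff] by (simp add: frontier_def interior_open)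
qed

text \<open>The points of the open edge on the frontier of \<open>f\<close> form a set that contains
  \<open>x\<close>, is relatively closed, and is relatively open by the local picture at each of its
  points. Connectedness gives the whole open edge, and closure adds its ends.\<close>

lemma side_imp_edge_of_face:
  assumes e: "e \<in> E" and s: "sides e x \<delta> L R" and f: "f = L \<or> f = R"
  shows "edge_of_face e f"
proof -
  let ?I = "inner_edge e"
  let ?A = "?I \<inter> frontier f"
  have ff: "f \<in> faces V E" using s f by (auto simp: sides_def)
  have "\<exists>r>0. ball y r \<inter> ?I \<subseteq> ?A" if y: "y \<in> ?A" for y
  proof -
    obtain r L' R' where r: "sides e y r L' R'"
      using sides_exist[OF e] y by blast
    have "y \<in> closure f" using y by (simp add: frontier_def)
    from frontier_side[OF e r ff this]
    have "ball y r \<inter> ?I \<subseteq> ?A" using sides_frontier[OF e r] by blast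
    then show ?thesis using r by (auto simp: sides_def)
  qed
  then have "openin (top_of_set ?I) ?A"
    by (auto simp: openin_contains_ball)
  moreover have "closedin (top_of_set ?I) ?A"
    by (intro closedin_closed_Int frontier_closed)
  moreover have "connected ?I"
    unfolding inner_edge_def by (intro convex_connected convex_open_segment)
  moreover have "x \<in> ?A"
    using sides_frontier[OF e s sides_inner_edge[OF s] _ f] s sides_inner_edge[OF s]
    by (auto simp: sides_def)
  ultimately have "?I \<subseteq> frontier f"
    unfolding connected_clopen by blast
  then have "closure ?I \<subseteq> frontier f"
    by (intro closure_minimal frontier_closed)
  then show ?thesis
    unfolding edge_of_face_def hull_edge[OF e] inner_edge_def
    using edge_ends(2)[OF e] by simp
qed

lemma edge_of_face_iff:
  assumes "e \<in> E" "sides e x \<delta> L R" "f \<in> faces V E"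
  shows "edge_of_face e f \<longleftrightarrow> f = L \<or> f = R"
proof
  assume "edge_of_face e f"
  then have "x \<in> frontier f"
    using sides_inner_edge[OF assms(2)] inner_edge_subset[OF assms(1)]
    by (auto simp: edge_of_face_def)
  then show "f = L \<or> f = R"
    using frontier_side[OF assms] by (simp add: frontier_def)
qed (use side_imp_edge_of_face assms in blast)

lemma frontier_face_subset_drawing:
  assumes "f \<in> faces V E"
  shows "frontier f \<subseteq> drawing V E"
proof
  fix y assume y: "y \<in> frontier f"
  show "y \<in> drawing V E"
  proof (rule ccontr)
    assume "y \<notin> drawing V E"
    then obtain f' where f': "f' \<in> faces V E" "{y} \<subseteq> f'"
      using connected_subset_face[of "{y}"] by auto
    have "y \<in> closure f" using y by (simp add: frontier_def)
    then have "f' \<inter> f \<noteq> {}"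
      using f'(2) open_Int_closure_eq_empty[OF open_faces[OF f'(1)], of f] by auto
    then have "f' = f" using faces_eq assms f'(1) by blast
    then show False using f'(2) y open_faces[OF assms] by (auto simp: frontier_def interior_open)
  qed
qed

lemma drawing_cases:
  assumes "x \<in> drawing V E"
  obtains "x \<in> V" | e where "e \<in> E" "x \<in> inner_edge e"
proof (cases "x \<in> V")
  case False
  then obtain e where e: "e \<in> E" "x \<in> convex hull e"
    using assms by (auto simp: drawing_def)
  then have "x \<in> inner_edge e"
    using False edge_ends(3,4)[OF e(1)] hull_edge[OF e(1)]
    by (auto simp: inner_edge_def open_segment_def)
  then show ?thesis using that e by blast
qed (use that in blast)

text \<open>A simple closed curve has infinitely many points, so the frontier contains a point
  outside the finite set \<open>V\<close>. That point is interior to an edge, and \<open>f\<close>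
  is one of the sides there.\<close>

lemma face_has_edge:
  assumes f: "f \<in> faces V E"
  obtains e where "e \<in> E" "edge_of_face e f"
proof -
  obtain \<gamma> where \<gamma>: "simple_path \<gamma>" "path_image \<gamma> = frontier f"
    using framework f by (auto simp: planar_framework_def)
  have "inj_on \<gamma> {0<..<1}"
  proof (rule inj_onI)
    fix s t assume st: "s \<in> {0<..<1}" "t \<in> {0<..<1}" "\<gamma> s = \<gamma> t"
    then have "s = t \<or> s = 0 \<and> t = 1 \<or> s = 1 \<and> t = 0"
      using \<gamma>(1) unfolding simple_path_def loop_free_def
      by (meson atLeastAtMost_iff greaterThanLessThan_iff less_imp_le)
    then show "s = t" using st by auto
  qed
  moreover have "\<gamma> ` {0<..<1} \<subseteq> frontier f"
    unfolding \<gamma>(2)[symmetric] path_image_def by auto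
  ultimately have "finite {0<..<1::real}" if "finite (frontier f)"
    using finite_imageD finite_subset[OF _ that] by blast
  then have "infinite (frontier f)"
    using infinite_Ioo[OF zero_less_one[where 'a=real]] by blast
  then have "\<not> frontier f \<subseteq> V"
    using finite_subset[OF _ finite_V] by blast
  then obtain x where x: "x \<in> frontier f" "x \<notin> V"
    by blast
  then obtain e where e: "e \<in> E" "x \<in> inner_edge e"
    using drawing_cases[of x] frontier_face_subset_drawing[OF f] by blast
  obtain \<delta> L R where s: "sides e x \<delta> L R" using sides_exist[OF e] .
  have "x \<in> closure f" using x by (simp add: frontier_def)
  from frontier_side[OF e(1) s f this] have "edge_of_face e f"
    using side_imp_edge_of_face[OF e(1) s] by blast
  then show ?thesis using that e(1) by blast
qed

lemma edge_has_sides: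
  assumes "e \<in> E"
  obtains x \<delta> L R where "sides e x \<delta> L R"
proof -
  have "midpoint (tail e) (head e) \<in> inner_edge e"
    using edge_ends(2)[OF assms] by (simp add: inner_edge_def)
  from sides_exist[OF assms this] that show ?thesis by blast
qed

text \<open>Each of the finitely many edges has at most two sides, and every face is a side of some
  edge.\<close>

lemma finite_faces: "finite (faces V E)"
proof -
  have "finite {f \<in> faces V E. edge_of_face e f}" if e: "e \<in> E" for e
  proof -
    obtain x \<delta> L R where s: "sides e x \<delta> L R" using edge_has_sides[OF e] .
    have "{f \<in> faces V E. edge_of_face e f} \<subseteq> {L, R}"
      using edge_of_face_iff[OF e s] by blast
    then show ?thesis by (rule finite_subset) simp
  qed
  then have "finite (\<Union>e\<in>E. {f \<in> faces V E. edge_of_face e f})"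
    using finite_E by blast
  moreover have "faces V E \<subseteq> (\<Union>e\<in>E. {f \<in> faces V E. edge_of_face e f})"
    using face_has_edge by blast
  ultimately show ?thesis by (rule rev_finite_subset)
qed

text \<open>The incidence numbers of \<open>f\<close> form a 1-cycle supported on its frontier, so
  their \<open>view_sum\<close> has one value on \<open>f\<close> and one outside its closure. The
  jump formula then gives \<sigma> as the difference of these values divided by 2 pi.\<close>

lemma face_sign:
  assumes f: "f \<in> faces V E"
  shows "\<exists>\<sigma>::real. \<forall>e\<in>E. \<forall>x \<delta> L R. sides e x \<delta> L R \<longrightarrow>
     of_int (sEF e f) = \<sigma> * (of_bool (f = L) - of_bool (f = R))"
proof -
  define C where "C e = real_of_int (sEF e f)" for e
  have cycle: "(\<Sum>e\<in>E. of_int (sVE v e) *\<^sub>R C e) = 0" if "v \<in> V" for v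
  proof -
    have "(\<Sum>e\<in>E. sVE v e * sEF e f) = 0"
      using incidence f that unfolding signed_incidence_def by blast
    from arg_cong[OF this, of real_of_int] show ?thesis by (simp add: C_def)
  qed
  have disj: "S \<inter> convex hull e = {}" if "S \<inter> frontier f = {}" "e \<in> E" "C e \<noteq> 0" for S e
  proof -
    have "edge_of_face e f"
      using incidence f that unfolding signed_incidence_def C_def by auto
    then show ?thesis using that(1) unfolding edge_of_face_def by blast
  qed
  have const: "\<exists>c. \<forall>z\<in>S. view_sum C z = c" if "open S" "connected S" "S \<inter> frontier f = {}" for S
    using view_sum_constant[OF cycle that(1,2) disj[OF that(3)]] by blast
  have "f \<inter> frontier f = {}" "- closure f \<inter> frontier f = {}"
    using open_faces[OF f] by (auto simp: frontier_def interior_open)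
  moreover have "connected (- closure f)"
  proof -
    obtain \<gamma> where "simple_path \<gamma>" "pathfinish \<gamma> = pathstart \<gamma>" "path_image \<gamma> = frontier f"
      using framework f by (auto simp: planar_framework_def)
    then show ?thesis
      by (rule connected_Compl_closure_of_Jordan_frontier[OF open_faces connected_faces faces_nonempty, OF f f f])
  qed
  ultimately obtain A B where A: "\<forall>z\<in>f. view_sum C z = A" and B: "\<forall>z\<in>- closure f. view_sum C z = B"
    using const[of f] const[of "- closure f"] open_faces[OF f] connected_faces[OF f] by auto
  \<comment> \<open>A face other than \<open>f\<close> is open and disjoint from \<open>f\<close>,
    so it lies outside the closure and carries the outer value.\<close>
  define val where "val K = (if f = K then A else B)" for K
  have val: "view_sum C z = val K" if K: "K \<in> faces V E" "z \<in> K" for K z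
  proof (cases "f = K")
    case False
    then have "K \<inter> f = {}" using faces_eq K(1) f by blast
    then have "K \<inter> closure f = {}"
      using open_faces[OF K(1)] by (simp add: open_Int_closure_eq_empty)
    then show ?thesis using B K False by (auto simp: val_def)
  qed (use A K in \<open>simp add: val_def\<close>)
  have "of_int (sEF e f) = (A - B) / (2 * pi) * (of_bool (f = L) - of_bool (f = R))"
    if e: "e \<in> E" and s: "sides e x \<delta> L R" for e x \<delta> L R
  proof -
    have "val L - val R = (2 * pi) *\<^sub>R C e"
      using s by (intro view_sum_jump[OF e sides_inner_edge[OF s] s] val) (auto simp: sides_def)
    then show ?thesis by (auto simp: val_def C_def field_simps split: if_splits)
  qed
  then show ?thesis by blast
qed

section \<open>Connectedness of the dual graph and the global sign\<close>

lemma face_near_point: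
  assumes "z \<notin> V" "0 < r"
  obtains f where "f \<in> faces V E" "f \<inter> ball z r \<noteq> {}"
proof (cases "z \<in> drawing V E")
  case True
  then obtain e where e: "e \<in> E" "z \<in> inner_edge e"
    using assms(1) drawing_cases by blast
  obtain \<delta> L R where s: "sides e z \<delta> L R" using sides_exist[OF e] .
  then have "z \<in> frontier L"
    using sides_frontier[OF e(1) s e(2)] by (auto simp: sides_def)
  then have "z \<in> closure L" by (simp add: frontier_def)
  then have "L \<inter> ball z r \<noteq> {}"
    using assms(2) unfolding closure_approachable by (force simp: dist_commute)
  then show ?thesis using that s by (auto simp: sides_def)
next
  case False
  then obtain f where "f \<in> faces V E" "{z} \<subseteq> f"
    using connected_subset_face[of "{z}"] by auto
  then have "f \<in> faces V E" "z \<in> f \<inter> ball z r" using assms(2) by auto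
  then show ?thesis using that by blast
qed

text \<open>The dual graph is connected because the plane minus the finite set V is connected.\<close>
lemma constant_on_faces:
  assumes F: "\<And>e x \<delta> L R. e \<in> E \<Longrightarrow> sides e x \<delta> L R \<Longrightarrow> F L = F R"
    and f: "f \<in> faces V E" "f' \<in> faces V E"
  shows "F f = F f'"
proof -
  \<comment> \<open>\<open>P z c\<close> says that all faces near \<open>z\<close> carry the value
    \<open>c\<close>. This makes sense on the drawing too, where \<open>z\<close> lies in no face,
    and \<open>c\<close> is unique off \<open>V\<close> because faces come arbitrarily close to
    \<open>z\<close>.\<close>
  define P where "P z c \<longleftrightarrow> (\<exists>r>0. \<forall>f\<in>faces V E. f \<inter> ball z r \<noteq> {} \<longrightarrow> F f = c)" for z c
  have unique: "c = c'" if z: "z \<notin> V" and P: "P z c" "P z c'" for z c c'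
  proof -
    obtain r r' where r: "0 < r" "\<forall>f\<in>faces V E. f \<inter> ball z r \<noteq> {} \<longrightarrow> F f = c"
      "0 < r'" "\<forall>f\<in>faces V E. f \<inter> ball z r' \<noteq> {} \<longrightarrow> F f = c'"
      using P unfolding P_def by auto
    have "0 < min r r'" using r by simp
    then obtain g where g: "g \<in> faces V E" "g \<inter> ball z (min r r') \<noteq> {}"
      using face_near_point[OF z] by metis
    have "ball z (min r r') \<subseteq> ball z r" "ball z (min r r') \<subseteq> ball z r'" by auto
    then show ?thesis using r g by blast
  qed
  have face: "P z (F g)" if g: "g \<in> faces V E" "z \<in> g" for g z
  proof -
    obtain r where r: "0 < r" "ball z r \<subseteq> g" using open_faces[OF g(1)] g(2) by (rule openE)
    have "F h = F g" if "h \<in> faces V E" "h \<inter> ball z r \<noteq> {}" for h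
      using faces_eq[OF that(1) g(1)] that r(2) by blast
    then show ?thesis using r(1) unfolding P_def by blast
  qed
  have ex: "\<exists>c. P z c" if z: "z \<notin> V" for z
  proof (cases "z \<in> drawing V E")
    case True
    then obtain e where e: "e \<in> E" "z \<in> inner_edge e"
      using z drawing_cases by blast
    obtain \<delta> L R where s: "sides e z \<delta> L R" using sides_exist[OF e] .
    have "F g = F L" if g: "g \<in> faces V E" "g \<inter> ball z \<delta> \<noteq> {}" for g
    proof -
      obtain y where y: "y \<in> g" "y \<in> ball z \<delta>" using g by blast
      have "y \<notin> inner_edge e"
        using y(1) g(1) e(1) faces_disjoint_drawing convex_hull_subset_drawing inner_edge_subset by blast
      then have "y \<in> L \<or> y \<in> R" "L \<in> faces V E" "R \<in> faces V E"
        using s y(2) unfolding sides_def by (meson linorder_less_linear)+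
      then have "g = L \<or> g = R"
        using faces_eq[OF g(1) _ y(1)] by blast
      then show ?thesis using F[OF e(1) s] by auto
    qed
    then show ?thesis unfolding P_def using s unfolding sides_def by blast
  next
    case False
    then obtain g where "g \<in> faces V E" "{z} \<subseteq> g"
      using connected_subset_face[of "{z}"] by auto
    then show ?thesis using face by blast
  qed
  \<comment> \<open>\<open>G\<close> extends \<open>F\<close> to a locally constant function on the
    plane without the finite set \<open>V\<close>, which is connected.\<close>
  define G where "G z = (THE c. P z c)" for z
  have G: "G z = c" if "z \<notin> V" "P z c" for z c
    unfolding G_def using that unique by blast
  have "connected (- V)"
    using connected_open_delete_finite[OF open_UNIV connected_UNIV _ finite_V] by (simp add: Compl_eq_Diff_UNIV)
  moreover obtain z z' where z: "z \<in> f" "z' \<in> f'" using faces_nonempty f by blast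
  moreover have zV: "z \<notin> V" "z' \<notin> V"
    using z f faces_disjoint_drawing unfolding drawing_def by blast+
  moreover have "\<forall>a\<in>-V. eventually (\<lambda>b. G a = G b) (at a within - V)"
  proof
    fix a assume "a \<in> - V"
    then have a: "a \<notin> V" by simp
    from ex[OF a] obtain c where c: "P a c" ..
    then obtain r where r: "0 < r" "\<forall>f\<in>faces V E. f \<inter> ball a r \<noteq> {} \<longrightarrow> F f = c"
      unfolding P_def by blast
    have "G b = c" if b: "b \<notin> V" "dist b a < r" for b
    proof (rule G[OF b(1)])
      have "ball b (r - dist b a) \<subseteq> ball a r"
        by (auto simp: dist_commute) (metis add.commute dist_commute dist_triangle_lt less_diff_eq)
      then have "\<forall>f\<in>faces V E. f \<inter> ball b (r - dist b a) \<noteq> {} \<longrightarrow> F f = c"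
        using r(2) by blast
      then show "P b c" using b(2) unfolding P_def
        by (intro exI[of _ "r - dist b a"]) simp
    qed
    then show "eventually (\<lambda>b. G a = G b) (at a within - V)"
      unfolding eventually_at using r(1) G[OF a c] by (intro exI[of _ r]) auto
  qed
  ultimately have "G z = G z'"
    using connected_local_const[of "- V" z z' G] by simp
  then show ?thesis
    using G[OF zV(1) face[OF f(1) z(1)]] G[OF zV(2) face[OF f(2) z(2)]] by simp
qed

text \<open>Consistent orientation makes the incidence numbers of an edge, which sum to
  \<open>s L - s R\<close>, cancel. So the signs of the faces agree across every edge and hence
  everywhere. Their common value is 1 or -1 because it is a nonzero incidence number.\<close>

lemma orientation_exists:
  "\<exists>\<sigma>::int. \<sigma> * \<sigma> = 1 \<and> (\<forall>e\<in>E. \<forall>f\<in>faces V E. \<forall>x \<delta> L R. sides e x \<delta> L R \<longrightarrow>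
     sEF e f = \<sigma> * (of_bool (f = L) - of_bool (f = R)))"
proof (cases "E = {}")
  case False
  have "\<exists>s. \<forall>f\<in>faces V E. \<forall>e\<in>E. \<forall>x \<delta> L R. sides e x \<delta> L R \<longrightarrow>
     real_of_int (sEF e f) = s f * (of_bool (f = L) - of_bool (f = R))"
    by (intro bchoice ballI face_sign)
  then obtain s where "\<forall>f\<in>faces V E. \<forall>e\<in>E. \<forall>x \<delta> L R. sides e x \<delta> L R \<longrightarrow>
     real_of_int (sEF e f) = s f * (of_bool (f = L) - of_bool (f = R))" ..
  then have s: "real_of_int (sEF e f) = s f * (of_bool (f = L) - of_bool (f = R))"
    if "f \<in> faces V E" "e \<in> E" "sides e x \<delta> L R" for f e x \<delta> L R
    using that by blast
  have eq: "s L = s R" if e: "e \<in> E" and sd: "sides e x \<delta> L R" for e x \<delta> L R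
  proof -
    have LR: "L \<in> faces V E" "R \<in> faces V E" using sd by (auto simp: sides_def)
    have "(\<Sum>f\<in>faces V E. sEF e f) = 0"
      using incidence e unfolding signed_incidence_def by blast
    then have "(\<Sum>f\<in>faces V E. real_of_int (sEF e f)) = 0"
      by (metis of_int_0 of_int_sum)
    also have "(\<Sum>f\<in>faces V E. real_of_int (sEF e f)) =
        (\<Sum>f\<in>faces V E. (if f = L then s f else 0) - (if f = R then s f else 0))"
      by (intro sum.cong refl) (simp add: s[OF _ e sd] algebra_simps)
    also have "\<dots> = s L - s R"
      using finite_faces LR by (simp add: sum_subtractf)
    finally show ?thesis by simp
  qed
  obtain e where e: "e \<in> E" using False by blast
  obtain x \<delta> L R where sd: "sides e x \<delta> L R" using edge_has_sides[OF e] .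
  have L: "L \<in> faces V E" using sd by (auto simp: sides_def)
  have "edge_of_face e L" using side_imp_edge_of_face[OF e sd] by blast
  then have ne: "sEF e L \<noteq> 0" "\<bar>sEF e L\<bar> \<le> 1"
    using incidence e L unfolding signed_incidence_def by blast+
  then have "sEF e L = 1 \<or> sEF e L = -1" by linarith
  then have sq: "sEF e L * sEF e L = 1" by auto
  \<comment> \<open>A nonzero incidence number excludes \<open>L = R\<close>, so the second
    indicator vanishes.\<close>
  have sL: "s L = real_of_int (sEF e L)"
    using s[OF L e sd] ne(1) by (auto split: if_splits)
  have all: "s f = real_of_int (sEF e L)" if "f \<in> faces V E" for f
    using constant_on_faces[of s, OF eq that L] sL by simp
  have "sEF e' f = sEF e L * (of_bool (f = L') - of_bool (f = R'))"
    if "e' \<in> E" "f \<in> faces V E" "sides e' x' \<delta>' L' R'" for e' f x' \<delta>' L' R'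
  proof -
    have "real_of_int (sEF e' f) = real_of_int (sEF e L * (of_bool (f = L') - of_bool (f = R')))"
      using s[OF that(2,1,3)] all[OF that(2)] by simp
    then show ?thesis by (simp only: of_int_eq_iff)
  qed
  then show ?thesis using sq by blast
\<comment> \<open>Without edges the condition is vacuous and 1 serves as a default.\<close>
qed (auto intro: exI[of _ 1])

text \<open>The value 1 is the convention in which the face to the left of an oriented edge has
  incidence number 1 with it (counterclockwise boundaries); -1 is the opposite convention.\<close>

definition orientation :: int where
  "orientation = (SOME \<sigma>. \<sigma> * \<sigma> = 1 \<and> (\<forall>e\<in>E. \<forall>f\<in>faces V E. \<forall>x \<delta> L R. sides e x \<delta> L R \<longrightarrow>
     sEF e f = \<sigma> * (of_bool (f = L) - of_bool (f = R))))"

lemma orientation_square: "orientation * orientation = 1"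
  and sEF_sides: "e \<in> E \<Longrightarrow> f \<in> faces V E \<Longrightarrow> sides e x \<delta> L R \<Longrightarrow>
     sEF e f = orientation * (of_bool (f = L) - of_bool (f = R))"
  using someI_ex[OF orientation_exists] unfolding orientation_def[symmetric] by blast+

end

section \<open>The connecting homomorphism\<close>

lemma kvec_diff: "kvec (x - y) = kvec x - kvec y"
  by (simp add: kvec_def vec_eq_iff)

lemma kvec_scaleR: "kvec (c *\<^sub>R x) = of_real c *s kvec x"
  by (simp add: kvec_def vec_eq_iff)

lemma kvec_eq_0_iff: "kvec x = 0 \<longleftrightarrow> x = 0"
  by (simp add: kvec_def vec_eq_iff)

lemma tauk_kvec: "tauk g (kvec x) = kvec (g *v x)"
  by (simp add: tauk_def kvec_def vec_eq_iff matrix_vector_mult_def)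

lemma tauk_scale: "tauk g (c *s x) = c *s tauk g x"
  by (simp add: tauk_def vec_eq_iff sum_distrib_left mult.left_commute)

lemma tauk_add: "tauk g (x + y) = tauk g x + tauk g y"
  by (simp add: tauk_def vec_eq_iff sum.distrib distrib_left)

lemma tauk_diff: "tauk g (x - y) = tauk g x - tauk g y"
  by (simp add: tauk_def vec_eq_iff sum_subtractf right_diff_distrib)

lemma tauk_0 [simp]: "tauk g 0 = 0"
  by (simp add: tauk_def vec_eq_iff)

lemma tauk_sum: "tauk g (sum h A) = (\<Sum>a\<in>A. tauk g (h a))"
  by (induction A rule: infinite_finite_induct) (simp_all add: tauk_add)

context oriented_framework
begin

text \<open>Every face other than the two sides has incidence number 0 with \<open>e\<close>, so the
  boundary measures the jump of \<xi> across the edge.\<close>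

lemma bd2_sides:
  assumes "e \<in> E" "sides e x \<delta> L R"
  shows "bd2 V E sEF \<xi> e = of_int orientation *s (\<xi> L - \<xi> R)"
proof -
  have "bd2 V E sEF \<xi> e = (\<Sum>f\<in>faces V E.
      of_int orientation *s ((if f = L then \<xi> f else 0) - (if f = R then \<xi> f else 0)))"
    unfolding bd2_def
    by (intro sum.cong refl) (auto simp: sEF_sides[OF assms(1) _ assms(2)] vec_eq_iff)
  also have "\<dots> = of_int orientation *s (\<xi> L - \<xi> R)"
    using assms(2) finite_faces
    by (simp add: vec.scale_sum_right[symmetric] sum_subtractf sides_def)
  finally show ?thesis .
qed

lemma edge_vec_eq:
  assumes "e \<in> E"
  shows "edge_vec sVE e = kvec (head e - tail e)"
proof -
  note ee = edge_ends[OF assms]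
  have "edge_vec sVE e = (\<Sum>v\<in>{tail e, head e}. of_int (sVE v e) *s kvec v)"
    unfolding edge_vec_def using ee(1) by (rule arg_cong)
  also have "\<dots> = kvec (head e - tail e)"
    using ee(2,5,6) by (simp add: kvec_diff vec_eq_iff)
  finally show ?thesis .
qed

lemma edge_vec_nonzero: "e \<in> E \<Longrightarrow> edge_vec sVE e \<noteq> 0"
  using edge_ends(2)[of e] by (simp add: edge_vec_eq kvec_eq_0_iff)

text \<open>The edge vector is nonzero, so the scalar selected by \<open>THE\<close> in
  \<open>theta\<close> is unique.\<close>

lemma theta_eqI:
  assumes "e \<in> E" "bd2 V E sEF \<xi> e = c *s edge_vec sVE e"
  shows "theta V E sVE sEF \<xi> e = c"
  using assms edge_vec_nonzero[OF assms(1)] unfolding theta_def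
  by (auto intro!: the_equality)

lemma theta_outside: "e \<notin> E \<Longrightarrow> theta V E sVE sEF \<xi> e = 0"
  by (simp add: theta_def)

lemma bd2_theta:
  assumes "\<xi> \<in> H2P V E sVE sEF" "e \<in> E"
  shows "bd2 V E sEF \<xi> e = theta V E sVE sEF \<xi> e *s edge_vec sVE e"
  using assms theta_eqI unfolding H2P_def by fastforce

lemma H2P_thetaI:
  assumes "\<And>f. f \<notin> faces V E \<Longrightarrow> \<xi> f = 0"
    and "\<And>e. e \<in> E \<Longrightarrow> bd2 V E sEF \<xi> e = w e *s edge_vec sVE e"
    and "\<And>e. e \<notin> E \<Longrightarrow> w e = 0"
  shows "\<xi> \<in> H2P V E sVE sEF" "theta V E sVE sEF \<xi> = w"
proof -
  show "\<xi> \<in> H2P V E sVE sEF"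
    using assms(1,2) unfolding H2P_def by blast
  show "theta V E sVE sEF \<xi> = w"
  proof
    show "theta V E sVE sEF \<xi> e = w e" for e
      using assms(3) theta_outside theta_eqI[OF _ assms(2)] by (cases "e \<in> E") simp_all
  qed
qed

lemma bd2_linear:
  "bd2 V E sEF (\<lambda>f. a *s \<xi> f + b *s \<zeta> f) e = a *s bd2 V E sEF \<xi> e + b *s bd2 V E sEF \<zeta> e"
  by (simp add: bd2_def vec_eq_iff sum.distrib sum_distrib_left algebra_simps)

lemma theta_linear:
  assumes "\<xi> \<in> H2P V E sVE sEF" "\<zeta> \<in> H2P V E sVE sEF"
  shows "(\<lambda>f. a *s \<xi> f + b *s \<zeta> f) \<in> H2P V E sVE sEF"
    and "theta V E sVE sEF (\<lambda>f. a *s \<xi> f + b *s \<zeta> f)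
      = (\<lambda>e. a * theta V E sVE sEF \<xi> e + b * theta V E sVE sEF \<zeta> e)"
proof -
  have *: "bd2 V E sEF (\<lambda>f. a *s \<xi> f + b *s \<zeta> f) e
      = (a * theta V E sVE sEF \<xi> e + b * theta V E sVE sEF \<zeta> e) *s edge_vec sVE e"
    if "e \<in> E" for e
    by (simp add: bd2_linear bd2_theta[OF assms(1) that] bd2_theta[OF assms(2) that]
        vec.scale_left_distrib)
  show "(\<lambda>f. a *s \<xi> f + b *s \<zeta> f) \<in> H2P V E sVE sEF"
    "theta V E sVE sEF (\<lambda>f. a *s \<xi> f + b *s \<zeta> f)
      = (\<lambda>e. a * theta V E sVE sEF \<xi> e + b * theta V E sVE sEF \<zeta> e)"
    using assms by (intro H2P_thetaI[OF _ *]; simp add: H2P_def theta_outside)+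
qed

text \<open>The stress sum at \<open>v\<close> is the double boundary of \<xi>; exchanging the sums
  exposes the incidence relation between \<open>v\<close> and each face, which makes it
  vanish.\<close>

lemma theta_in_H1F:
  assumes "\<xi> \<in> H2P V E sVE sEF"
  shows "theta V E sVE sEF \<xi> \<in> H1F V E sVE"
proof -
  have "(\<Sum>e\<in>E. (of_int (sVE v e) * theta V E sVE sEF \<xi> e) *s edge_vec sVE e) = 0"
    if v: "v \<in> V" for v
  proof -
    have "(\<Sum>e\<in>E. (of_int (sVE v e) * theta V E sVE sEF \<xi> e) *s edge_vec sVE e)
        = (\<Sum>e\<in>E. of_int (sVE v e) *s bd2 V E sEF \<xi> e)"
      by (intro sum.cong refl) (simp add: bd2_theta[OF assms])
    also have "\<dots> = (\<Sum>f\<in>faces V E. \<Sum>e\<in>E. of_int (sVE v e * sEF e f) *s \<xi> f)"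
      unfolding bd2_def vec.scale_sum_right by (subst sum.swap) simp
    also have "\<dots> = (\<Sum>f\<in>faces V E. of_int (\<Sum>e\<in>E. sVE v e * sEF e f) *s \<xi> f)"
      by (simp add: vec.scale_sum_left)
    also have "\<dots> = 0"
      using incidence v unfolding signed_incidence_def by (intro sum.neutral) simp
    finally show ?thesis .
  qed
  then show ?thesis by (simp add: H1F_def theta_outside)
qed

lemma bd2_Tconst:
  assumes "\<xi> \<in> Tconst V E" "e \<in> E"
  shows "bd2 V E sEF \<xi> e = 0"
proof -
  obtain x \<delta> L R where s: "sides e x \<delta> L R" using edge_has_sides[OF assms(2)] .
  then have "\<xi> L = \<xi> R" using assms(1) by (auto simp: Tconst_def sides_def)
  then show ?thesis by (simp add: bd2_sides[OF assms(2) s])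
qed

text \<open>A vanishing \<open>theta\<close> means that \<xi> does not jump across any edge, and the
  dual graph is connected.\<close>

lemma theta_kernel: "{\<xi> \<in> H2P V E sVE sEF. theta V E sVE sEF \<xi> = (\<lambda>e. 0)} = Tconst V E"
proof (intro equalityI subsetI)
  fix \<xi> assume "\<xi> \<in> Tconst V E"
  then show "\<xi> \<in> {\<xi> \<in> H2P V E sVE sEF. theta V E sVE sEF \<xi> = (\<lambda>e. 0)}"
    using H2P_thetaI[of \<xi> "\<lambda>e. 0"] bd2_Tconst[of \<xi>] by (auto simp: Tconst_def)
next
  fix \<xi> assume "\<xi> \<in> {\<xi> \<in> H2P V E sVE sEF. theta V E sVE sEF \<xi> = (\<lambda>e. 0)}"
  then have \<xi>: "\<xi> \<in> H2P V E sVE sEF" "theta V E sVE sEF \<xi> = (\<lambda>e. 0)" by auto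
  have o: "orientation \<noteq> 0" using orientation_square by auto
  have "\<xi> L = \<xi> R" if e: "e \<in> E" and s: "sides e x \<delta> L R" for e x \<delta> L R
  proof -
    have "of_int orientation *s (\<xi> L - \<xi> R) = 0"
      using bd2_theta[OF \<xi>(1) e] \<xi>(2) bd2_sides[OF e s, of \<xi>] by simp
    then show ?thesis using o by simp
  qed
  then have c: "\<xi> f = \<xi> f'" if "f \<in> faces V E" "f' \<in> faces V E" for f f'
    using constant_on_faces[of \<xi>] that by blast
  have 0: "\<xi> f = 0" if "f \<notin> faces V E" for f
    using \<xi>(1) that by (simp add: H2P_def)
  show "\<xi> \<in> Tconst V E"
  proof (cases "faces V E = {}")
    case True
    then show ?thesis using 0 by (auto simp: Tconst_def)
  next
    case False
    then obtain f0 where f0: "f0 \<in> faces V E" by blast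
    have "\<xi> f = (if f \<in> faces V E then \<xi> f0 else 0)" for f
      using 0[of f] c[OF _ f0, of f] by (cases "f \<in> faces V E") simp_all
    then show ?thesis unfolding Tconst_def by blast
  qed
qed

text \<open>Equilibrium of \<open>w\<close> says that \<open>C\<close> is a 1-cycle with vector
  coefficients. Its view sum is constant on each face and jumps across \<open>e\<close> by a
  multiple of the edge vector, so its face values form a reciprocal diagram.\<close>

lemma theta_surj:
  fixes w :: "(real^2) set \<Rightarrow> 'k::real_normed_field"
  assumes w: "w \<in> H1F V E sVE"
  obtains \<xi> where "\<xi> \<in> H2P V E sVE sEF" "theta V E sVE sEF \<xi> = w"
proof -
  have scaleR: "r *\<^sub>R x = of_real r *s x" for r and x :: "'k^2"
    unfolding vec_eq_iff vector_scaleR_component vector_smult_component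
    by (simp add: scaleR_conv_of_real)
  define C :: "(real^2) set \<Rightarrow> 'k^2" where "C e = w e *s edge_vec sVE e" for e
  have cycle: "(\<Sum>e\<in>E. of_int (sVE v e) *\<^sub>R C e) = 0" if "v \<in> V" for v
    using w that unfolding H1F_def C_def scaleR by simp
  \<comment> \<open>The factor removes the 2 pi of the jump and the sign in \<open>bd2\<close>,
    which is its own inverse. The view sum is constant on \<open>f\<close>, so the choice of the
    point is immaterial; \<open>H2P\<close> demands 0 off the faces.\<close>
  define \<xi> where "\<xi> f = (if f \<in> faces V E
      then (of_int orientation / (2 * pi)) *\<^sub>R view_sum C (SOME z. z \<in> f) else 0)" for f
  have \<xi>: "view_sum C z = (of_int orientation * (2 * pi)) *\<^sub>R \<xi> f" if f: "f \<in> faces V E" "z \<in> f" for f z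
  proof -
    have "(SOME z. z \<in> f) \<in> f" using f(2) by (rule someI)
    moreover have "f \<inter> convex hull e = {}" if "e \<in> E" for e
      using that faces_disjoint_drawing[OF f(1)] convex_hull_subset_drawing by blast
    ultimately have "view_sum C z = view_sum C (SOME z. z \<in> f)"
      using f by (intro view_sum_constant[where S = f] cycle open_faces connected_faces)
    moreover have "real_of_int orientation * real_of_int orientation = 1"
      using orientation_square by (metis of_int_1 of_int_mult)
    ultimately show ?thesis using f(1) by (simp add: \<xi>_def)
  qed
  have bd: "bd2 V E sEF \<xi> e = w e *s edge_vec sVE e" if e: "e \<in> E" for e
  proof -
    obtain x \<delta> L R where s: "sides e x \<delta> L R" using edge_has_sides[OF e] .
    have "(of_int orientation * (2 * pi)) *\<^sub>R \<xi> L - (of_int orientation * (2 * pi)) *\<^sub>R \<xi> R = (2 * pi) *\<^sub>R C e"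
      using s by (intro view_sum_jump[OF e sides_inner_edge[OF s] s] \<xi>) (auto simp: sides_def)
    then have "(2 * pi) *\<^sub>R (of_int orientation *\<^sub>R (\<xi> L - \<xi> R)) = (2 * pi) *\<^sub>R C e"
      by (simp add: scaleR_right_diff_distrib mult.commute)
    then have "of_int orientation *\<^sub>R (\<xi> L - \<xi> R) = C e"
      unfolding scaleR_cancel_left by simp
    then show ?thesis
      by (simp add: bd2_sides[OF e s] scaleR C_def)
  qed
  show ?thesis
    using w by (intro that[of \<xi>] H2P_thetaI[OF _ bd]) (auto simp: \<xi>_def H1F_def)
qed

end

section \<open>Symmetries\<close>

lemma orthogonal_matrix_inverse:
  fixes g :: "real^2^2"
  assumes "orthogonal_matrix g"
  shows "matrix_inv g = transpose g" "g ** matrix_inv g = mat 1" "matrix_inv g ** g = mat 1"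
    "orthogonal_matrix (matrix_inv g)"
proof -
  have o: "transpose g ** g = mat 1" "g ** transpose g = mat 1"
    using assms by (auto simp: orthogonal_matrix_def)
  have "g ** matrix_inv g = mat 1 \<and> matrix_inv g ** g = mat 1"
    unfolding matrix_inv_def by (rule someI[of _ "transpose g"]) (simp add: o)
  then show i: "g ** matrix_inv g = mat 1" "matrix_inv g ** g = mat 1"
    by blast+
  have "matrix_inv g = (transpose g ** g) ** matrix_inv g" by (simp add: o)
  also have "\<dots> = transpose g" by (simp add: matrix_mul_assoc[symmetric] i)
  finally show "matrix_inv g = transpose g" .
  then show "orthogonal_matrix (matrix_inv g)"
    using assms by (simp add: orthogonal_matrix_transpose)
qed

lemma gact_set_inverse:
  assumes "orthogonal_matrix g"
  shows "gact_set (matrix_inv g) (gact_set g c) = c" "gact_set g (gact_set (matrix_inv g) c) = c"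
  by (simp_all add: gact_set_def image_image matrix_vector_mul_assoc
      orthogonal_matrix_inverse(2,3)[OF assms])

text \<open>Rotations commute and reflections anticommute with the quarter turn. This is the source
  of the sign \<open>det g\<close>: a reflection exchanges left and right of an edge.\<close>

lemma perp_orthogonal:
  fixes g :: "real^2^2"
  assumes "orthogonal_matrix g"
  shows "perp (g *v x) = det g *\<^sub>R (g *v perp x)"
proof -
  have o: "transpose g ** g = mat 1"
    using assms by (simp add: orthogonal_matrix_def)
  obtain a b c d where e: "g $ 1 $ 1 = a" "g $ 1 $ 2 = b" "g $ 2 $ 1 = c" "g $ 2 $ 2 = d" by blast
  have "(transpose g ** g) $ i $ j = (mat 1 :: real^2^2) $ i $ j" for i j by (simp add: o)
  from this[of 1 1] this[of 2 2] this[of 1 2]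
  have r: "a * a + c * c = 1" "b * b + d * d = 1" "a * b + c * d = 0"
    by (simp_all add: matrix_matrix_mult_def transpose_def mat_def sum_2 e)
  \<comment> \<open>Entry by entry, determinant times matrix equals the cofactor matrix.\<close>
  have "(a * d - b * c) * a = d" "(a * d - b * c) * b = - c"
    "(a * d - b * c) * c = - b" "(a * d - b * c) * d = a"
    using r by algebra+
  then show ?thesis
    by (simp add: vec_eq_iff forall_2 perp_def matrix_vector_mult_def sum_2 det_2 e
        distrib_left right_diff_distrib mult.assoc[symmetric])
qed

section \<open>One isometry acting on faces and incidence numbers\<close>

locale symmetric_framework = oriented_framework +
  fixes g :: "real^2^2"
  assumes orth: "orthogonal_matrix g"
    and V_inv: "(\<lambda>x. g *v x) ` V = V"
    and E_inv: "gact_set g ` E = E"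
begin

text \<open>Inclusions proved for \<open>g\<close> can be reversed by applying them to its
  inverse.\<close>

lemma symmetric_framework_inverse: "symmetric_framework V E sVE sEF (matrix_inv g)"
proof
  show "orthogonal_matrix (matrix_inv g)" using orthogonal_matrix_inverse[OF orth] by simp
  have "(\<lambda>x. matrix_inv g *v x) ` (\<lambda>x. g *v x) ` V = V"
    using gact_set_inverse(1)[OF orth, of V] by (simp add: gact_set_def)
  then show "(\<lambda>x. matrix_inv g *v x) ` V = V" by (simp add: V_inv)
  have "gact_set (matrix_inv g) ` gact_set g ` E = E"
    by (simp add: image_image gact_set_inverse[OF orth])
  then show "gact_set (matrix_inv g) ` E = E" by (simp add: E_inv)
qed

lemma inner_g: "(g *v x) \<bullet> (g *v y) = x \<bullet> y"
proof -
  have "(g *v x) \<bullet> (g *v y) = (x v* transpose g) \<bullet> (g *v y)"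
    by (simp only: vector_transpose_matrix)
  also have "\<dots> = x \<bullet> ((transpose g ** g) *v y)"
    by (simp only: dot_lmul_matrix matrix_vector_mul_assoc)
  finally show ?thesis using orth by (simp add: orthogonal_matrix_def)
qed

lemma norm_g: "norm (g *v x) = norm x"
  by (simp add: norm_eq_sqrt_inner inner_g)

lemma linear_g: "linear ((*v) g)"
  by (rule matrix_vector_mul_linear)

lemma inj_g: "inj ((*v) g)"
  using orth by (metis inj_matrix_vector_mult invertible_def orthogonal_matrix_def)

lemma gact_set_E: "e \<in> E \<Longrightarrow> gact_set g e \<in> E"
  using E_inv by blast

lemma gact_set_drawing: "gact_set g (drawing V E) = drawing V E"
proof -
  have "gact_set g (drawing V E) = gact_set g V \<union> \<Union> ((\<lambda>e. gact_set g (convex hull e)) ` E)"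
    unfolding drawing_def gact_set_def by blast
  also have "(\<lambda>e. gact_set g (convex hull e)) = (\<lambda>e. convex hull (gact_set g e))"
    unfolding gact_set_def by (simp add: convex_hull_linear_image[OF linear_g])
  also have "\<Union> ((\<lambda>e. convex hull (gact_set g e)) ` E) = \<Union> ((\<lambda>e. convex hull e) ` (gact_set g ` E))"
    by simp
  also have "gact_set g V = V" using V_inv by (simp add: gact_set_def)
  finally show ?thesis
    unfolding E_inv drawing_def[symmetric] .
qed

lemma gact_set_subset_face:
  assumes "f \<in> faces V E"
  obtains f' where "f' \<in> faces V E" "gact_set g f \<subseteq> f'"
proof -
  have "connected (gact_set g f)"
    unfolding gact_set_def using connected_faces[OF assms]
    by (rule connected_continuous_image[OF linear_continuous_on[OF matrix_vector_mul_bounded_linear]])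
  moreover have "gact_set g f \<noteq> {}"
    using faces_nonempty[OF assms] by (simp add: gact_set_def)
  moreover have "gact_set g f \<inter> drawing V E = {}"
  proof -
    have "gact_set g f \<inter> gact_set g (drawing V E) = gact_set g (f \<inter> drawing V E)"
      unfolding gact_set_def using inj_g by (simp add: image_Int)
    then show ?thesis
      by (simp add: gact_set_drawing faces_disjoint_drawing[OF assms]) (simp add: gact_set_def)
  qed
  ultimately show ?thesis using that by (rule connected_subset_face)
qed

text \<open>Connectedness only puts the image inside some face \<open>f'\<close>. The inverse moves
  \<open>f'\<close> into a face that contains \<open>f\<close>, hence into \<open>f\<close>, and
  this turns the inclusion into an equality.\<close>

lemma gact_set_face:
  assumes "f \<in> faces V E"
  shows "gact_set g f \<in> faces V E"
proof -
  obtain f' where f': "f' \<in> faces V E" "gact_set g f \<subseteq> f'"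
    using gact_set_subset_face[OF assms] .
  interpret inv: symmetric_framework V E sVE sEF "matrix_inv g"
    by (rule symmetric_framework_inverse)
  obtain f'' where f'': "f'' \<in> faces V E" "gact_set (matrix_inv g) f' \<subseteq> f''"
    using inv.gact_set_subset_face[OF f'(1)] .
  have "gact_set (matrix_inv g) (gact_set g f) \<subseteq> gact_set (matrix_inv g) f'"
    using f'(2) by (auto simp: gact_set_def)
  then have "f \<subseteq> f''" using f''(2) by (simp add: gact_set_inverse[OF orth])
  then have "f'' = f" using faces_nonempty[OF assms] faces_eq[OF f''(1) assms] by blast
  then have "gact_set g (gact_set (matrix_inv g) f') \<subseteq> gact_set g f"
    using f''(2) by (auto simp: gact_set_def)
  then have "f' \<subseteq> gact_set g f" by (simp add: gact_set_inverse[OF orth])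
  then show ?thesis using f' by (metis subset_antisym)
qed

lemma bij_betw_faces: "bij_betw (gact_set g) (faces V E) (faces V E)"
proof -
  interpret inv: symmetric_framework V E sVE sEF "matrix_inv g"
    by (rule symmetric_framework_inverse)
  show ?thesis
    by (rule bij_betw_byWitness[where f' = "gact_set (matrix_inv g)"])
       (auto simp: gact_set_inverse[OF orth] gact_set_face inv.gact_set_face)
qed

lemma gact_set_inv_faces_iff: "gact_set (matrix_inv g) f \<in> faces V E \<longleftrightarrow> f \<in> faces V E"
proof -
  interpret inv: symmetric_framework V E sVE sEF "matrix_inv g"
    by (rule symmetric_framework_inverse)
  show ?thesis
    by (metis gact_set_face inv.gact_set_face gact_set_inverse(2)[OF orth])
qed

text \<open>The integer \<epsilon> is the sign [ge,e].\<close>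
lemma edge_transport:
  assumes e: "e \<in> E"
  obtains \<epsilon> :: int where "\<epsilon> = 1 \<or> \<epsilon> = -1"
    and "head (gact_set g e) - tail (gact_set g e) = of_int \<epsilon> *\<^sub>R (g *v (head e - tail e))"
    and "inner_edge (gact_set g e) = gact_set g (inner_edge e)"
proof -
  let ?h = "head (gact_set g e)" and ?t = "tail (gact_set g e)"
  have ge: "gact_set g e \<in> E" using gact_set_E[OF e] .
  have "{?t, ?h} = gact_set g {tail e, head e}"
    using edge_ends(1)[OF e] edge_ends(1)[OF ge] by metis
  then have "{?t, ?h} = {g *v tail e, g *v head e}" by (simp add: gact_set_def)
  then consider "?t = g *v tail e" "?h = g *v head e" | "?t = g *v head e" "?h = g *v tail e"
    by (auto simp: doubleton_eq_iff)
  moreover have "gact_set g (inner_edge e) = open_segment (g *v tail e) (g *v head e)"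
    unfolding gact_set_def inner_edge_def
    by (rule open_segment_linear_image[OF linear_g inj_g, symmetric])
  ultimately show ?thesis
  proof cases
    case 1
    then show ?thesis
      using \<open>gact_set g (inner_edge e) = _\<close>
      by (intro that[of 1]) (simp_all add: inner_edge_def matrix_vector_mult_diff_distrib)
  next
    case 2
    then show ?thesis
      using \<open>gact_set g (inner_edge e) = _\<close>
      by (intro that[of "-1"])
         (simp_all add: inner_edge_def matrix_vector_mult_diff_distrib open_segment_commute)
  qed
qed

text \<open>The isometry carries the local picture at \<open>x\<close> to one at
  \<open>g *v x\<close>. The sign \<open>\<epsilon> * det g\<close> compares the transported normal
  with the normal of the transported edge and so decides whether left and right are kept or
  exchanged.\<close>

lemma sEF_transport:
  assumes e: "e \<in> E" and \<epsilon>: "\<epsilon> = 1 \<or> \<epsilon> = (-1::int)"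
    and dir: "head (gact_set g e) - tail (gact_set g e) = of_int \<epsilon> *\<^sub>R (g *v (head e - tail e))"
    and inn: "inner_edge (gact_set g e) = gact_set g (inner_edge e)"
    and f: "f \<in> faces V E"
  shows "real_of_int (sEF (gact_set g e) (gact_set g f)) = of_int \<epsilon> * det g * of_int (sEF e f)"
proof -
  let ?A = "gact_set g"
  obtain x \<delta> L R where s: "sides e x \<delta> L R" using edge_has_sides[OF e] .
  have det: "det g = 1 \<or> det g = -1" using det_orthogonal_matrix[OF orth] .
  define k where "k = of_int \<epsilon> * det g"
  have k: "k = 1 \<or> k = -1" using \<epsilon> det by (auto simp: k_def)
  have perp_scale: "perp (c *\<^sub>R y) = c *\<^sub>R perp y" for c y
    by (simp add: perp_def vec_eq_iff forall_2)
  have n: "edge_normal (?A e) = k *\<^sub>R (g *v edge_normal e)"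
    unfolding edge_normal_def dir by (simp add: perp_orthogonal[OF orth] perp_scale k_def)
  have ball: "\<exists>z\<in>ball x \<delta>. y = g *v z" if "y \<in> ball (g *v x) \<delta>" for y
  proof (rule bexI)
    show y: "y = g *v (matrix_inv g *v y)"
      by (simp add: matrix_vector_mul_assoc orthogonal_matrix_inverse(2)[OF orth])
    have "dist (g *v x) (g *v (matrix_inv g *v y)) < \<delta>"
      using that y by simp
    then show "matrix_inv g *v y \<in> ball x \<delta>"
      by (simp add: dist_norm matrix_vector_mult_diff_distrib[symmetric] norm_g)
  qed
  have inner: "edge_normal (?A e) \<bullet> (g *v z - g *v x) = k * (edge_normal e \<bullet> (z - x))" for z
    by (simp add: n matrix_vector_mult_diff_distrib[symmetric] inner_g)
  have LR: "L \<in> faces V E" "R \<in> faces V E" using s by (auto simp: sides_def)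
  have A_in: "g *v z \<in> ?A S" if "z \<in> S" for z S using that by (auto simp: gact_set_def)
  have eq: "?A K = ?A K' \<longleftrightarrow> K = K'" for K K'
    by (metis gact_set_inverse(1)[OF orth])
  have faces: "?A f \<in> faces V E" "?A L \<in> faces V E" "?A R \<in> faces V E"
    using gact_set_face f LR by blast+
  have loc: "(0 < edge_normal e \<bullet> (z - x) \<longrightarrow> g *v z \<in> ?A L) \<and>
        (edge_normal e \<bullet> (z - x) < 0 \<longrightarrow> g *v z \<in> ?A R) \<and>
        (edge_normal e \<bullet> (z - x) = 0 \<longrightarrow> g *v z \<in> ?A (inner_edge e))" if "z \<in> ball x \<delta>" for z
    using s that A_in unfolding sides_def by blast
  have \<delta>: "0 < \<delta>" using s by (simp add: sides_def)
  show ?thesis using k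
  proof
    assume k1: "k = 1"
    have "(0 < edge_normal (?A e) \<bullet> (y - g *v x) \<longrightarrow> y \<in> ?A L) \<and>
        (edge_normal (?A e) \<bullet> (y - g *v x) < 0 \<longrightarrow> y \<in> ?A R) \<and>
        (edge_normal (?A e) \<bullet> (y - g *v x) = 0 \<longrightarrow> y \<in> inner_edge (?A e))"
      if "y \<in> ball (g *v x) \<delta>" for y
    proof -
      from ball[OF that] obtain z where z: "z \<in> ball x \<delta>" and y: "y = g *v z" ..
      show ?thesis using loc[OF z] unfolding y inner k1 inn by simp
    qed
    then have "sides (?A e) (g *v x) \<delta> (?A L) (?A R)"
      unfolding sides_def using faces \<delta> by blast
    from sEF_sides[OF gact_set_E[OF e] faces(1) this] have "sEF (?A e) (?A f) = sEF e f"
      unfolding eq sEF_sides[OF e f s] .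
    then show ?thesis unfolding k_def[symmetric] k1 by simp
  next
    \<comment> \<open>Here the image of \<open>L\<close> lies to the right of the transported edge
      and the image of \<open>R\<close> to the left.\<close>
    assume k1: "k = -1"
    have "(0 < edge_normal (?A e) \<bullet> (y - g *v x) \<longrightarrow> y \<in> ?A R) \<and>
        (edge_normal (?A e) \<bullet> (y - g *v x) < 0 \<longrightarrow> y \<in> ?A L) \<and>
        (edge_normal (?A e) \<bullet> (y - g *v x) = 0 \<longrightarrow> y \<in> inner_edge (?A e))"
      if "y \<in> ball (g *v x) \<delta>" for y
    proof -
      from ball[OF that] obtain z where z: "z \<in> ball x \<delta>" and y: "y = g *v z" ..
      show ?thesis using loc[OF z] unfolding y inner k1 inn by simp
    qed
    then have "sides (?A e) (g *v x) \<delta> (?A R) (?A L)"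
      unfolding sides_def using faces \<delta> by blast
    from sEF_sides[OF gact_set_E[OF e] faces(1) this] have "sEF (?A e) (?A f) = - sEF e f"
      unfolding eq sEF_sides[OF e f s] by (simp add: algebra_simps)
    then show ?thesis unfolding k_def[symmetric] k1 by simp
  qed
qed

text \<open>Reindexing along the permutation of the faces cancels the inverse in
  \<open>actP\<close>.\<close>

lemma sum_faces_actP:
  fixes \<xi> :: "(real^2) set \<Rightarrow> 'k::real_field^2"
  shows "(\<Sum>f\<in>faces V E. h f *s actP g \<xi> f)
    = (\<Sum>f\<in>faces V E. (h (gact_set g f) * of_real (det g)) *s tauk g (\<xi> f))"
  by (subst sum.reindex_bij_betw[OF bij_betw_faces, symmetric])
     (simp add: actP_def gact_set_inverse[OF orth])

text \<open>One factor \<open>det g\<close> comes from \<open>actP\<close> and one from the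
  transported incidence numbers; they cancel. The remaining \<epsilon> is the sign by which the edge
  vector changes, so the scalar itself is carried over without a sign, as \<open>actF\<close>
  prescribes.\<close>

lemma theta_equivariant:
  fixes \<xi> :: "(real^2) set \<Rightarrow> 'k::real_field^2"
  assumes \<xi>: "\<xi> \<in> H2P V E sVE sEF"
  shows "actP g \<xi> \<in> H2P V E sVE sEF"
    and "theta V E sVE sEF (actP g \<xi>) = actF g (theta V E sVE sEF \<xi>)"
proof -
  interpret inv: symmetric_framework V E sVE sEF "matrix_inv g"
    by (rule symmetric_framework_inverse)
  have det: "det g * det g = 1" using det_orthogonal_matrix[OF orth] by auto
  have bd: "bd2 V E sEF (actP g \<xi>) (gact_set g e)
      = theta V E sVE sEF \<xi> e *s edge_vec sVE (gact_set g e)" if e: "e \<in> E" for e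
  proof -
    obtain \<epsilon> :: int where \<epsilon>: "\<epsilon> = 1 \<or> \<epsilon> = -1"
      "head (gact_set g e) - tail (gact_set g e) = of_int \<epsilon> *\<^sub>R (g *v (head e - tail e))"
      "inner_edge (gact_set g e) = gact_set g (inner_edge e)"
      using edge_transport[OF e] .
    have coeff: "(of_int (sEF (gact_set g e) (gact_set g f)) * of_real (det g) :: 'k)
        = of_int \<epsilon> * of_int (sEF e f)" if f: "f \<in> faces V E" for f
    proof -
      have "real_of_int (sEF (gact_set g e) (gact_set g f)) * det g = of_int \<epsilon> * of_int (sEF e f)"
        using det by (simp add: sEF_transport[OF e \<epsilon> f])
      from arg_cong[OF this, of "of_real :: real \<Rightarrow> 'k"] show ?thesis by simp
    qed
    have "bd2 V E sEF (actP g \<xi>) (gact_set g e)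
        = (\<Sum>f\<in>faces V E. of_int \<epsilon> *s tauk g (of_int (sEF e f) *s \<xi> f))"
      unfolding bd2_def sum_faces_actP
      by (intro sum.cong refl) (simp add: coeff tauk_scale)
    also have "\<dots> = of_int \<epsilon> *s tauk g (bd2 V E sEF \<xi> e)"
      by (simp add: bd2_def tauk_sum vec.scale_sum_right)
    also have "\<dots> = theta V E sVE sEF \<xi> e *s (of_int \<epsilon> *s tauk g (edge_vec sVE e))"
      by (simp add: bd2_theta[OF \<xi> e] tauk_scale mult.commute)
    also have "of_int \<epsilon> *s tauk g (edge_vec sVE e) = (edge_vec sVE (gact_set g e) :: 'k^2)"
      by (simp add: edge_vec_eq[OF e] edge_vec_eq[OF gact_set_E[OF e]] tauk_kvec \<epsilon>(2) kvec_scaleR)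
    finally show ?thesis .
  qed
  have 1: "bd2 V E sEF (actP g \<xi>) e = actF g (theta V E sVE sEF \<xi>) e *s edge_vec sVE e"
    if e: "e \<in> E" for e
    using bd[OF inv.gact_set_E[OF e]] by (simp add: gact_set_inverse[OF orth] actF_def)
  have 0: "actP g \<xi> f = 0" if "f \<notin> faces V E" for f
    using \<xi> that by (simp add: H2P_def actP_def gact_set_inv_faces_iff)
  have 2: "actF g (theta V E sVE sEF \<xi>) e = 0" if "e \<notin> E" for e
  proof -
    have "gact_set (matrix_inv g) e \<notin> E"
      using that gact_set_E gact_set_inverse(2)[OF orth] by metis
    then show ?thesis by (simp add: actF_def theta_outside)
  qed
  show "actP g \<xi> \<in> H2P V E sVE sEF"
    "theta V E sVE sEF (actP g \<xi>) = actF g (theta V E sVE sEF \<xi>)"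
    using H2P_thetaI[OF 0 1 2] by blast+
qed

end

section \<open>Isotypic components\<close>

definition is_copy :: "('k::field \<Rightarrow> 'a::ab_group_add \<Rightarrow> 'a) \<Rightarrow> (real^2^2) set
    \<Rightarrow> (real^2^2 \<Rightarrow> 'a \<Rightarrow> 'a) \<Rightarrow> (real^2^2 \<Rightarrow> 'k^'n^'n) \<Rightarrow> 'a set \<Rightarrow> 'a set \<Rightarrow> bool" where
  "is_copy sc G act \<mu> S W \<longleftrightarrow> W \<subseteq> S \<and> module.subspace sc W \<and> (\<forall>g\<in>G. act g ` W \<subseteq> W) \<and>
     (\<exists>L. (\<forall>x y. L (x + y) = L x + L y) \<and> (\<forall>c x. L (c *s x) = sc c (L x)) \<and>
        bij_betw L UNIV W \<and> (\<forall>g\<in>G. \<forall>x. L (\<mu> g *v x) = act g (L x)))"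

lemma isotypic_eq_span:
  "isotypic sc G act S \<mu> = module.span sc (\<Union> {W. is_copy sc G act \<mu> S W})"
  by (simp only: isotypic_def is_copy_def)

lemma isotypic_subset:
  assumes "vector_space sc" "module.subspace sc S"
  shows "isotypic sc G act S \<mu> \<subseteq> S"
proof -
  interpret vector_space sc by fact
  show ?thesis
    unfolding isotypic_eq_span is_copy_def using assms(2)
    by (intro span_minimal Union_least) simp_all
qed

text \<open>Schur's lemma: on a copy of the irreducible \<mu> an equivariant map is zero or injective.\<close>
lemma isotypic_image:
  fixes \<mu> :: "real^2^2 \<Rightarrow> 'k::field^'n^'n"
    and sc :: "'k \<Rightarrow> 'a::ab_group_add \<Rightarrow> 'a" and sc' :: "'k \<Rightarrow> 'b::ab_group_add \<Rightarrow> 'b"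
  assumes vs: "vector_space sc" "vector_space sc'"
    and M: "module.subspace sc M"
    and \<phi>: "\<And>x. x \<in> M \<Longrightarrow> \<phi> x \<in> N"
    and add: "\<And>x y. x \<in> M \<Longrightarrow> y \<in> M \<Longrightarrow> \<phi> (x + y) = \<phi> x + \<phi> y"
    and scale: "\<And>c x. x \<in> M \<Longrightarrow> \<phi> (sc c x) = sc' c (\<phi> x)"
    and equiv: "\<And>g x. g \<in> G \<Longrightarrow> x \<in> M \<Longrightarrow> \<phi> (act g x) = act' g (\<phi> x)"
    and act0: "\<And>g. act' g 0 = 0"
    and irr: "irrep G \<mu>"
  shows "\<phi> ` isotypic sc G act M \<mu> \<subseteq> isotypic sc' G act' N \<mu>"
proof -
  interpret v1: vector_space sc by fact
  interpret v2: vector_space sc' by fact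
  define X where "X = \<Union> {W. is_copy sc G act \<mu> M W}"
  define Y where "Y = \<Union> {W. is_copy sc' G act' \<mu> N W}"
  have \<phi>0: "\<phi> 0 = 0"
    using scale[OF v1.subspace_0[OF M], of 0] by simp
  have gen: "\<phi> x \<in> v2.span Y" if "x \<in> X" for x
  proof -
    obtain W where W: "x \<in> W" "is_copy sc G act \<mu> M W"
      using \<open>x \<in> X\<close> unfolding X_def by blast
    have WM: "W \<subseteq> M"
      using W(2) unfolding is_copy_def by (rule conjunct1)
    obtain L where L: "\<And>x y. L (x + y) = L x + L y" "\<And>c x. L (c *s x) = sc c (L x)"
        "bij_betw L UNIV W" "\<And>g x. g \<in> G \<Longrightarrow> L (\<mu> g *v x) = act g (L x)"
      using W(2) unfolding is_copy_def by (elim conjE exE) metis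
    have LM: "L v \<in> M" for v using L(3) WM by (auto simp: bij_betw_def)
    define K where "K v = \<phi> (L v)" for v
    have K: "K (v + w) = K v + K w" "K (c *s v) = sc' c (K v)" for v w c
      by (simp_all add: K_def L(1,2) add scale LM)
    have Kg: "K (\<mu> g *v v) = act' g (K v)" if "g \<in> G" for g v
      by (simp add: K_def L(4) that equiv LM)
    have "vec.subspace {v. K v = 0}"
      using K(2)[of 0] by (simp add: vec.subspace_def K)
    moreover have "\<forall>g\<in>G. \<forall>v\<in>{v. K v = 0}. \<mu> g *v v \<in> {v. K v = 0}"
      by (simp add: Kg act0)
    moreover have "\<forall>U. vec.subspace U \<and> (\<forall>g\<in>G. \<forall>x\<in>U. \<mu> g *v x \<in> U) \<longrightarrow> U = {0} \<or> U = UNIV"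
      using irr unfolding irrep_def by (elim conjE)
    ultimately have "{v. K v = 0} = {0} \<or> {v. K v = 0} = UNIV"
      by blast
    then show ?thesis
    proof
      assume "{v. K v = 0} = UNIV"
      moreover obtain v where "x = L v" using L(3) W(1) by (auto simp: bij_betw_def)
      ultimately have "\<phi> x = 0" by (auto simp: K_def)
      then show ?thesis by (simp add: v2.span_zero)
    next
      \<comment> \<open>An injective \<open>K\<close> makes its range a copy of \<mu> inside
        \<open>N\<close>, and this copy contains \<open>\<phi> x\<close>.\<close>
      assume ker: "{v. K v = 0} = {0}"
      have "inj K"
      proof (rule injI)
        fix v w assume eq: "K v = K w"
        have "K (v - w) = K v - K w" using K(1)[of "v - w" w] by simp
        then have "K (v - w) = 0" using eq by simp
        then have "v - w \<in> {v. K v = 0}" by simp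
        then show "v = w" unfolding ker by simp
      qed
      then have b: "bij_betw K UNIV (range K)" by (simp add: bij_betw_def)
      have "v2.subspace (range K)"
        unfolding v2.subspace_def
      proof (intro conjI ballI allI)
        have "K 0 = 0" using K(2)[of 0 0] by simp
        then show "0 \<in> range K" by (metis rangeI)
        show "x + y \<in> range K" if "x \<in> range K" "y \<in> range K" for x y
          using that by (auto simp: K(1)[symmetric])
        show "sc' c x \<in> range K" if "x \<in> range K" for c x
          using that by (auto simp: K(2)[symmetric])
      qed
      moreover have "range K \<subseteq> N" using \<phi> LM by (auto simp: K_def)
      moreover have "\<forall>g\<in>G. act' g ` range K \<subseteq> range K"
        by (auto simp: Kg[symmetric])
      ultimately have "is_copy sc' G act' \<mu> N (range K)"
        unfolding is_copy_def using b K Kg by (intro conjI exI[of _ K]) simp_all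
      then have "range K \<subseteq> Y"
        unfolding Y_def by blast
      moreover have "\<phi> x \<in> range K"
        using L(3) W(1) by (auto simp: bij_betw_def K_def)
      ultimately show ?thesis using v2.span_base by blast
    qed
  qed
  have XM: "X \<subseteq> M" unfolding X_def is_copy_def by (rule Union_least) simp
  \<comment> \<open>Membership in \<open>M\<close> is carried through the induction because
    additivity of \<phi> is available only there.\<close>
  have "x \<in> M \<and> \<phi> x \<in> v2.span Y" if "x \<in> v1.span X" for x
    using that
  proof (induction rule: v1.span_induct_alt)
    case base
    show ?case by (simp add: v1.subspace_0[OF M] \<phi>0 v2.span_zero)
  next
    case (step c x y)
    then have "x \<in> M" using XM by blast
    with step M show ?case
      by (simp add: add scale v1.subspace_add v1.subspace_scale v2.span_add v2.span_scale gen)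
  qed
  then show ?thesis
    unfolding isotypic_eq_span X_def[symmetric] Y_def[symmetric] by blast
qed

section \<open>Linear structures and exactness on isotypic components\<close>

lemma vector_space_scP: "vector_space (scP :: 'k::field \<Rightarrow> _)"
  by unfold_locales (simp_all add: scP_def fun_eq_iff vec_eq_iff algebra_simps)

lemma vector_space_scF: "vector_space (scF :: 'k::field \<Rightarrow> _)"
  by unfold_locales (simp_all add: scF_def fun_eq_iff algebra_simps)

lemma actF_0: "actF g 0 = 0"
  by (simp add: actF_def fun_eq_iff)

lemma actP_0: "actP g 0 = 0"
  by (simp add: actP_def fun_eq_iff)

text \<open>Equivariant maps give inclusions between isotypic components; equalities need maps in
  the opposite direction. The projection \<open>p\<close> onto the kernel supplies them:
  \<open>p\<close> itself and the section of \<open>th\<close> whose values are killed by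
  \<open>p\<close>.\<close>

lemma isotypic_exact:
  fixes \<mu> :: "real^2^2 \<Rightarrow> 'k::field^'n^'n"
    and sc1 :: "'k \<Rightarrow> 'a::ab_group_add \<Rightarrow> 'a" and sc2 :: "'k \<Rightarrow> 'b::ab_group_add \<Rightarrow> 'b"
  assumes vs: "vector_space sc1" "vector_space sc2"
    and M: "module.subspace sc1 M"
    and th_add: "\<And>x y. x \<in> M \<Longrightarrow> y \<in> M \<Longrightarrow> th (x + y) = th x + th y"
    and th_scale: "\<And>c x. x \<in> M \<Longrightarrow> th (sc1 c x) = sc2 c (th x)"
    and th_equiv: "\<And>g x. g \<in> G \<Longrightarrow> x \<in> M \<Longrightarrow> th (act1 g x) = act2 g (th x)"
    and th_onto: "th ` M = N"
    and kernel: "{x \<in> M. th x = 0} = T"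
    and act_M: "\<And>g x. g \<in> G \<Longrightarrow> x \<in> M \<Longrightarrow> act1 g x \<in> M"
    and act_0: "\<And>g. act1 g 0 = 0" "\<And>g. act2 g 0 = 0"
    and p: "\<And>x. x \<in> M \<Longrightarrow> p x \<in> T" "\<And>x. x \<in> T \<Longrightarrow> p x = x"
    and p_add: "\<And>x y. p (x + y) = p x + p y"
    and p_scale: "\<And>c x. p (sc1 c x) = sc1 c (p x)"
    and p_equiv: "\<And>g x. g \<in> G \<Longrightarrow> x \<in> M \<Longrightarrow> p (act1 g x) = act1 g (p x)"
    and irr: "irrep G \<mu>"
  shows "isotypic sc1 G act1 T \<mu> \<subseteq> isotypic sc1 G act1 M \<mu>"
    and "th ` isotypic sc1 G act1 M \<mu> = isotypic sc2 G act2 N \<mu>"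
    and "{x \<in> isotypic sc1 G act1 M \<mu>. th x = 0} = isotypic sc1 G act1 T \<mu>"
proof -
  interpret v1: vector_space sc1 by fact
  interpret v2: vector_space sc2 by fact
  let ?I = "\<lambda>S. isotypic sc1 G act1 S \<mu>"
  have TM: "T \<subseteq> M" using kernel by blast
  have MN: "th x \<in> N" if "x \<in> M" for x using that th_onto by blast
  have M_diff: "x - y \<in> M" if "x \<in> M" "y \<in> M" for x y using that v1.subspace_diff[OF M] by blast
  have T: "v1.subspace T"
    unfolding kernel[symmetric] v1.subspace_def
    using M th_scale[OF v1.subspace_0[OF M], of 0]
    by (auto simp: th_add th_scale v1.subspace_add v1.subspace_scale v1.subspace_0)
  have N: "v2.subspace N"
    unfolding th_onto[symmetric] v2.subspace_def
  proof (intro conjI ballI allI)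
    show "0 \<in> th ` M"
      using th_scale[OF v1.subspace_0[OF M], of 0] v1.subspace_0[OF M] by (auto simp: image_iff intro!: bexI[of _ 0])
    show "x + y \<in> th ` M" if "x \<in> th ` M" "y \<in> th ` M" for x y
      using that th_add M by (auto simp: image_iff) (metis v1.subspace_add)
    show "sc2 c x \<in> th ` M" if "x \<in> th ` M" for c x
      using that th_scale M by (auto simp: image_iff) (metis v1.subspace_scale)
  qed
  show TI: "?I T \<subseteq> ?I M"
    unfolding isotypic_eq_span
    by (rule v1.span_mono, rule Union_mono, unfold is_copy_def) (use TM in auto)
  have IM: "?I M \<subseteq> M" and IT: "?I T \<subseteq> T"
    by (intro isotypic_subset vs M T)+
  have fwd: "th ` ?I M \<subseteq> isotypic sc2 G act2 N \<mu>"
    by (rule isotypic_image[where sc = sc1 and sc' = sc2 and \<phi> = th and M = M and N = N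
      and G = G and act = act1 and act' = act2 and \<mu> = \<mu>])
      (fact vs M MN th_add th_scale th_equiv act_0 irr)+

  \<comment> \<open>the section of th with values in the complement of T given by p\<close>
  define s where "s w = (let y = (SOME y. y \<in> M \<and> th y = w) in y - p y)" for w
  have pp: "p (y - p y) = 0" if "y \<in> M" for y
  proof -
    have "p (y - p y) + p (p y) = p y" using p_add[of "y - p y" "p y"] by simp
    then show ?thesis using p that by simp
  qed
  have thT: "th (y - p y) = th y" if "y \<in> M" for y
  proof -
    have "p y \<in> M" "th (p y) = 0" using p(1)[OF that] kernel by auto
    then show ?thesis using th_add[of "y - p y" "p y"] M_diff that by simp
  qed
  have s: "s w \<in> M" "th (s w) = w" "p (s w) = 0" if w: "w \<in> N" for w
  proof -
    define y where "y = (SOME y. y \<in> M \<and> th y = w)"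
    have y: "y \<in> M" "th y = w"
      using someI_ex[of "\<lambda>y. y \<in> M \<and> th y = w"] w th_onto unfolding y_def by blast+
    have "s w = y - p y" by (simp add: s_def y_def Let_def)
    then show "s w \<in> M" "th (s w) = w" "p (s w) = 0"
      using y pp thT p(1)[OF y(1)] TM M_diff by auto
  qed
  \<comment> \<open>Two preimages killed by \<open>p\<close> differ by an element of
    \<open>T\<close>, which \<open>p\<close> both fixes and kills. This uniqueness makes
    \<open>s\<close> linear and equivariant although it is defined by a choice.\<close>
  have s_eqI: "s w = x" if w: "x \<in> M" "th x = w" "p x = 0" for w x
  proof -
    have wN: "w \<in> N" using w MN by blast
    note sw = s[OF wN]
    have d: "s w - x \<in> M" using sw w M_diff by blast
    have "th (s w - x) + th x = th (s w)" using th_add[OF d w(1)] by simp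
    then have "s w - x \<in> T" using d kernel sw w by auto
    moreover have "p (s w - x) + p x = p (s w)" using p_add[of "s w - x" x] by simp
    ultimately show ?thesis using p(2) sw w by fastforce
  qed
  have act_p0: "p (act1 g x) = 0" if "g \<in> G" "x \<in> M" "p x = 0" for g x
    using p_equiv[OF that(1,2)] that(3) act_0 by simp
  have "s ` isotypic sc2 G act2 N \<mu> \<subseteq> ?I M"
  proof (rule isotypic_image[where sc = sc2 and sc' = sc1 and \<phi> = s and M = N and N = M
      and G = G and act = act2 and act' = act1 and \<mu> = \<mu>])
    show "s (x + y) = s x + s y" if "x \<in> N" "y \<in> N" for x y
      using that M by (intro s_eqI) (simp_all add: s th_add p_add v1.subspace_add)
    show "s (sc2 c x) = sc1 c (s x)" if "x \<in> N" for c x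
      using that M by (intro s_eqI) (simp_all add: s th_scale p_scale v1.subspace_scale)
    show "s (act2 g x) = act1 g (s x)" if "g \<in> G" "x \<in> N" for g x
      using that by (intro s_eqI) (simp_all add: s th_equiv act_M act_p0)
  qed (fact vs N s(1) act_0 irr)+
  then have sI: "s w \<in> ?I M" if "w \<in> isotypic sc2 G act2 N \<mu>" for w
    using that by blast
  have IN: "isotypic sc2 G act2 N \<mu> \<subseteq> N" by (intro isotypic_subset vs N)
  have "isotypic sc2 G act2 N \<mu> \<subseteq> th ` ?I M"
  proof
    fix w assume w: "w \<in> isotypic sc2 G act2 N \<mu>"
    then have "w = th (s w)" using s(2) IN by auto
    then show "w \<in> th ` ?I M" using sI[OF w] by (rule image_eqI)
  qed
  with fwd show "th ` ?I M = isotypic sc2 G act2 N \<mu>" by blast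

  \<comment> \<open>An isotypic element of \<open>M\<close> in the kernel of \<open>th\<close> lies
    in \<open>T\<close>, so \<open>p\<close> fixes it and thereby places it in the isotypic
    component of \<open>T\<close>.\<close>
  have "p ` ?I M \<subseteq> ?I T"
    by (rule isotypic_image[where sc = sc1 and sc' = sc1 and \<phi> = p and M = M and N = T
      and G = G and act = act1 and act' = act1 and \<mu> = \<mu>])
      (simp_all add: vs M p p_add p_scale p_equiv act_0 irr)
  then have pI: "p x \<in> ?I T" if "x \<in> ?I M" for x
    using that by blast
  have "x \<in> ?I T" if x: "x \<in> ?I M" "th x = 0" for x
  proof -
    have "x \<in> T" using x IM kernel by blast
    then show ?thesis using pI[OF x(1)] p(2) by simp
  qed
  moreover have "th x = 0" if "x \<in> ?I T" for x
    using that IT kernel by blast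
  ultimately show "{x \<in> ?I M. th x = 0} = ?I T" using TI by blast
qed

section \<open>Splitting by the mean over faces\<close>

context oriented_framework
begin

text \<open>A linear projection onto \<open>T\<close> that commutes with the action because
  \<open>g\<close> permutes the faces.\<close>

definition face_mean :: "((real^2) set \<Rightarrow> 'k::real_field^2) \<Rightarrow> (real^2) set \<Rightarrow> 'k^2" where
  "face_mean \<xi> f = (if f \<in> faces V E then inverse (of_nat (card (faces V E))) *s (\<Sum>f\<in>faces V E. \<xi> f) else 0)"

lemma face_mean_Tconst: "face_mean \<xi> \<in> Tconst V E"
  unfolding Tconst_def face_mean_def by auto

lemma face_mean_id:
  assumes "\<xi> \<in> Tconst V E"
  shows "face_mean \<xi> = \<xi>"
proof
  fix f
  obtain c where c: "\<And>f. \<xi> f = (if f \<in> faces V E then c else 0)"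
    using assms unfolding Tconst_def by blast
  have "(\<Sum>f\<in>faces V E. \<xi> f) = of_nat (card (faces V E)) *s c"
    by (simp add: c) (simp add: vec_eq_iff of_nat_index)
  moreover have "card (faces V E) \<noteq> 0" if "f \<in> faces V E"
    using that finite_faces by auto
  ultimately show "face_mean \<xi> f = \<xi> f"
    by (auto simp: face_mean_def c)
qed

lemma face_mean_add: "face_mean (\<xi> + \<zeta>) = face_mean \<xi> + face_mean \<zeta>"
  by (simp add: face_mean_def fun_eq_iff sum.distrib vec.scale_right_distrib)

lemma face_mean_scale: "face_mean (scP c \<xi>) = scP c (face_mean \<xi>)"
  by (simp add: face_mean_def fun_eq_iff scP_def vec.scale_sum_right mult.commute)

lemma subspace_H2P: "module.subspace scP (H2P V E sVE sEF :: ((real^2) set \<Rightarrow> 'k::real_field^2) set)"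
proof -
  interpret vector_space "scP :: 'k \<Rightarrow> _" by (rule vector_space_scP)
  have "(\<lambda>f. 0) \<in> H2P V E sVE sEF"
    by (rule H2P_thetaI[where w = "\<lambda>e. 0"]) (simp_all add: bd2_def)
  then show ?thesis
    unfolding subspace_def
    using theta_linear(1)[of _ _ 1 1] theta_linear(1)[of _ _ _ 0]
    by (auto simp: scP_def plus_fun_def zero_fun_def)
qed

end

lemma (in symmetric_framework) face_mean_actP: "face_mean (actP g \<xi>) = actP g (face_mean \<xi>)"
proof
  fix f
  have "(\<Sum>f\<in>faces V E. actP g \<xi> f) = of_real (det g) *s tauk g (\<Sum>f\<in>faces V E. \<xi> f)"
    using sum_faces_actP[of "\<lambda>_. 1" \<xi>] by (simp add: tauk_sum vec.scale_sum_right)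
  then show "face_mean (actP g \<xi>) f = actP g (face_mean \<xi>) f"
    by (simp add: face_mean_def actP_def gact_set_inv_faces_iff tauk_scale mult.commute)
qed

text \<open>A real normed field as scalars covers real and complex coefficients at once; the norm
  serves to differentiate view sums with coefficients in k^2.\<close>

lemma (in oriented_framework) ses_claim_orthogonal_group:
  fixes \<mu> :: "real^2^2 \<Rightarrow> 'k::real_normed_field^'n^'n"
  assumes orth: "\<And>g. g \<in> G \<Longrightarrow> orthogonal_matrix g"
    and sym: "G_framework G V E"
    and irr: "irrep G \<mu>"
  shows "ses_claim G V E sVE sEF \<mu>"
proof -
  let ?M = "H2P V E sVE sEF :: ((real^2) set \<Rightarrow> 'k^2) set" and ?th = "theta V E sVE sEF"
  have sf: "symmetric_framework V E sVE sEF g" if "g \<in> G" for g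
    using sym orth[OF that] that
    by unfold_locales (auto simp: G_framework_def gact_set_def[abs_def])
  note equiv = symmetric_framework.theta_equivariant[OF sf]
  have lin: "?th (\<lambda>f. a *s \<xi> f + b *s \<zeta> f) = (\<lambda>e. a * ?th \<xi> e + b * ?th \<zeta> e)"
    if "\<xi> \<in> ?M" "\<zeta> \<in> ?M" for \<xi> \<zeta> a b
    using that by (rule theta_linear)
  have th_add: "?th (\<xi> + \<zeta>) = ?th \<xi> + ?th \<zeta>" if "\<xi> \<in> ?M" "\<zeta> \<in> ?M" for \<xi> \<zeta>
    using lin[OF that, of 1 1] by (simp add: plus_fun_def)
  have th_scale: "?th (scP c \<xi>) = scF c (?th \<xi>)" if "\<xi> \<in> ?M" for c \<xi>
    using lin[OF that that, of c 0] by (simp add: scP_def scF_def)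
  have onto: "?th ` ?M = H1F V E sVE"
    using theta_in_H1F theta_surj by (metis (no_types, lifting) image_iff subsetI subset_antisym)
  have kernel: "{\<xi> \<in> ?M. ?th \<xi> = 0} = Tconst V E"
    using theta_kernel by (simp add: zero_fun_def)
  note exact = isotypic_exact[where th = ?th and M = ?M and G = G and p = face_mean
      and ?sc1.0 = scP and ?sc2.0 = scF and ?act1.0 = actP and ?act2.0 = actF and \<mu> = \<mu>
      and N = "H1F V E sVE" and T = "Tconst V E",
      OF vector_space_scP vector_space_scF subspace_H2P th_add th_scale equiv(2) onto kernel
      equiv(1) actP_0 actF_0 face_mean_Tconst face_mean_id face_mean_add face_mean_scale
      symmetric_framework.face_mean_actP[OF sf] irr]
  show ?thesis
    unfolding ses_claim_def Let_def
    using lin exact by (simp add: zero_fun_def equiv(2))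
qed

section \<open>Application to the cyclic and dihedral groups\<close>

lemma orthogonal_matrix_rot: "orthogonal_matrix (rot t)"
proof -
  have "sin t * sin t + cos t * cos t = 1"
    using sin_cos_squared_add[of t] by (simp add: power2_eq_square)
  then show ?thesis
    by (simp add: orthogonal_matrix_def rot_def matrix_matrix_mult_def transpose_def mat_def
        vec_eq_iff forall_2 sum_2 algebra_simps)
qed

lemma orthogonal_matrix_group:
  assumes "G = cyclic_grp m \<or> (\<exists>s. is_reflection s \<and> G = dihedral_grp m s)" "g \<in> G"
  shows "orthogonal_matrix g"
  using assms
  by (auto simp: dihedral_grp_def cyclic_grp_def is_reflection_def
      intro!: orthogonal_matrix_mul orthogonal_matrix_rot)

theorem mainTheorem7:
  fixes G :: "(real^2^2) set" and m :: nat
    and V :: "(real^2) set" and E :: "(real^2) set set"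
    and sVE :: "real^2 \<Rightarrow> (real^2) set \<Rightarrow> int"
    and sEF :: "(real^2) set \<Rightarrow> (real^2) set \<Rightarrow> int"
  assumes "m \<ge> 1"
    and "G = cyclic_grp m \<or> (\<exists>s. is_reflection s \<and> G = dihedral_grp m s)"
    and "planar_framework V E"
    and "G_framework G V E"
    and "signed_incidence V E sVE sEF"
  shows "(\<forall>\<mu> :: real^2^2 \<Rightarrow> real^'n^'n. irrep G \<mu> \<longrightarrow> ses_claim G V E sVE sEF \<mu>) \<and>
         (\<forall>\<mu> :: real^2^2 \<Rightarrow> complex^'n^'n. irrep G \<mu> \<longrightarrow> ses_claim G V E sVE sEF \<mu>)"
proof -
  interpret oriented_framework V E sVE sEF
    using assms(3,5) by unfold_locales
  show ?thesis
    by (intro conjI allI impI ses_claim_orthogonal_group orthogonal_matrix_group[OF assms(2)] assms(4))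
qed

end
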